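(* Let $\mathbf p=(p_1,\dots,p_r)$ and $\mathbf q=(q_1,\dots,q_r)$ be probability distributions on $\mathcal X=\{c_1,\dots,c_r\}$ with $p_j>0$ and $q_j>0$ for all $j\in D$, and let $\alpha>0$, $\alpha\ne1$. Let $\widehat{\mathbf p}_n$ and $\widehat{\mathbf q}_m$ be the empirical distributions of i.i.d. samples $X_1,\dots,X_n$ from $\mathbf p$ and $Y_1,\dots,Y_m$ from $\mathbf q$. Then the following hold, where $\rightsquigarrow$ denotes convergence in distribution. (a) (One sample) As $n\to+\infty$, $$\sqrt n\,\bigl(\mathcal D_{R,\alpha}(\widehat{\mathbf p}_n,\mathbf q)-\mathcal D_{R,\alpha}(\mathbf p,\mathbf q)\bigr)\rightsquigarrow\mathcal N\bigl(0,V_{R,\alpha,1}(\mathbf p,\mathbf q)\bigr),\qquad\sqrt n\,\bigl(\mathcal D_{R,\alpha}(\mathbf p,\widehat{\mathbf q}_n)-\mathcal D_{R,\alpha}(\mathbf p,\mathbf q)\bigr)\rightsquigarrow\mathcal N\bigl(0,V_{R,\alpha,2}(\mathbf p,\mathbf q)\bigr).$$ (b) (Two samples) For $(n,m)\to(+\infty,+\infty)$ and $nm/(n+m)\to\gamma\in(0,1)$, $$\left(\frac{mn}{nV_{R,\alpha,2}(\mathbf p,\mathbf q)+mV_{R,\alpha,1}(\mathbf p,\mathbf q)}\right)^{1/2}\bigl(\mathcal D_{R,\alpha}(\widehat{\mathbf p}_n,\widehat{\mathbf q}_m)-\mathcal D_{R,\alpha}(\mathbf p,\mathbf q)\bigr)\rightsquigarrow\mathcal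 N(0,1).$$
   Context: $\mathcal X=\{c_1,\dots,c_r\}$ with $r\ge 2$ is a finite set and $D=\{1,\dots,r\}$. A probability distribution $\mathbf p$ on $\mathcal X$ is identified with the vector $(p_1,\dots,p_r)$, $p_j$ being the mass of $c_j$. $X_1,X_2,\dots$ are i.i.d. with $\mathbb P(X_i=c_j)=p_j$, and $Y_1,Y_2,\dots$ are i.i.d. with $\mathbb P(Y_i=c_j)=q_j$; the two samples are independent of each other. Empirical probabilities: $\widehat p_n^{c_j}=\frac1n\sum_{i=1}^n 1_{\{X_i=c_j\}}$, $\widehat q_m^{c_j}=\frac1m\sum_{i=1}^m 1_{\{Y_i=c_j\}}$, $\widehat{\mathbf p}_n=(\widehat p_n^{c_j})_{j\in D}$, $\widehat{\mathbf q}_m=(\widehat q_m^{c_j})_{j\in D}$. $\mathcal S_\alpha(\mathbf p,\mathbf q)=\sum_{j\in D}p_j^\alpha q_j^{1-\alpha}$; Renyi-$\alpha$ divergence: $\mathcal D_{R,\alpha}(\mathbf p,\mathbf q)=\frac1{\alpha-1}\log\mathcal S_\alpha(\mathbf p,\mathbf q)$ (natural logarithm). $$V_{T,\alpha,1}(\mathbf p,\mathbf q)=\Bigl(\frac{\alpha}{\alpha-1}\Bigr)^2\Bigl(\sum_{j\in D}p_j(1-p_j)(p_j/q_j)^{2\alpha-2}-2\sum_{(i,j)\in D^2,\ i\neq j}(p_ip_j)^{\alpha}(q_iq_j)^{1-\alpha}\Bigr),$$ $$V_{T,\alpha,2}(\mathbf p,\mathbf q)=\sum_{j\in D}q_j(1-q_j)(p_j/q_j)^{2\alpha}-2\sum_{(i,j)\in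 D^2,\ i\neq j}(p_ip_j)^{\alpha}(q_iq_j)^{1-\alpha},$$ $$V_{R,\alpha,1}(\mathbf p,\mathbf q)=\frac{V_{T,\alpha,1}(\mathbf p,\mathbf q)}{\mathcal S_\alpha^2(\mathbf p,\mathbf q)},\qquad V_{R,\alpha,2}(\mathbf p,\mathbf q)=\frac{V_{T,\alpha,2}(\mathbf p,\mathbf q)}{\mathcal S_\alpha^2(\mathbf p,\mathbf q)}.$$
   Formalization: In V_{T,α,1}, V_{T,α,2} the cross sums run over i<j (over i≠j they are not the variances and can be negative); (b) assumes nm/(n+m)→γ or m/(n+m)→γ, as the former is impossible for n,m→+∞, and that nV_{R,α,2}+mV_{R,α,1} is eventually nonzero (it is 0 if p=q). *)

theory Defs
  imports "HOL-Probability.Probability"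
begin

text \<open>
  A distribution on \<open>{c 1, \<dots>, c r}\<close> is represented by its vector of masses, a function
  \<open>p :: nat \<Rightarrow> real\<close> of which only the values on \<open>{1..r}\<close> matter.
\<close>

definition emp_prob :: "(nat \<Rightarrow> 'w \<Rightarrow> 'a) \<Rightarrow> nat \<Rightarrow> 'a \<Rightarrow> 'w \<Rightarrow> real" where
  "emp_prob X n x \<omega> = 1 / real n * (\<Sum>i=1..n. of_bool (X i \<omega> = x))"

definition S_alpha :: "nat \<Rightarrow> real \<Rightarrow> (nat \<Rightarrow> real) \<Rightarrow> (nat \<Rightarrow> real) \<Rightarrow> real" where
  "S_alpha r \<alpha> p q = (\<Sum>j=1..r. p j powr \<alpha> * q j powr (1 - \<alpha>))"

text \<open>
  Empirical masses may vanish. In HOL, \<open>0 powr x = 0\<close> and \<open>ln 0 = 0\<close>, so where the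
  divergence is classically infinite (a zero mass under a negative exponent, or \<open>S_alpha = 0\<close>)
  the function below takes a finite value. For empirical masses of fully supported
  distributions this happens only on events whose probability tends to zero, so that it is
  irrelevant for limits in distribution.
\<close>

definition renyi_div :: "nat \<Rightarrow> real \<Rightarrow> (nat \<Rightarrow> real) \<Rightarrow> (nat \<Rightarrow> real) \<Rightarrow> real" where
  "renyi_div r \<alpha> p q = 1 / (\<alpha> - 1) * ln (S_alpha r \<alpha> p q)"

text \<open>
  In the cross terms, which carry the factor 2, every unordered pair of distinct indices is
  counted once (hence \<open>i < j\<close>). This is what makes the expressions variances: for weights
  \<open>a\<close>, the variance of the sum of the \<open>a j\<close> times the indicator of outcome \<open>j\<close> is the sum of
  the \<open>(a j)^2 * p j * (1 - p j)\<close> minus twice the sum over \<open>i < j\<close> of the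
  \<open>a i * a j * p i * p j\<close>.
\<close>

definition V_T1 :: "nat \<Rightarrow> real \<Rightarrow> (nat \<Rightarrow> real) \<Rightarrow> (nat \<Rightarrow> real) \<Rightarrow> real" where
  "V_T1 r \<alpha> p q = (\<alpha> / (\<alpha> - 1))\<^sup>2 *
     ((\<Sum>j=1..r. p j * (1 - p j) * (p j / q j) powr (2 * \<alpha> - 2)) -
      2 * (\<Sum>(i, j) \<in> {(i, j) \<in> {1..r} \<times> {1..r}. i < j}.
             (p i * p j) powr \<alpha> * (q i * q j) powr (1 - \<alpha>)))"

definition V_T2 :: "nat \<Rightarrow> real \<Rightarrow> (nat \<Rightarrow> real) \<Rightarrow> (nat \<Rightarrow> real) \<Rightarrow> real" where
  "V_T2 r \<alpha> p q =
     (\<Sum>j=1..r. q j * (1 - q j) * (p j / q j) powr (2 * \<alpha>)) -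
      2 * (\<Sum>(i, j) \<in> {(i, j) \<in> {1..r} \<times> {1..r}. i < j}.
             (p i * p j) powr \<alpha> * (q i * q j) powr (1 - \<alpha>))"

definition V_R1 :: "nat \<Rightarrow> real \<Rightarrow> (nat \<Rightarrow> real) \<Rightarrow> (nat \<Rightarrow> real) \<Rightarrow> real" where
  "V_R1 r \<alpha> p q = V_T1 r \<alpha> p q / (S_alpha r \<alpha> p q)\<^sup>2"

definition V_R2 :: "nat \<Rightarrow> real \<Rightarrow> (nat \<Rightarrow> real) \<Rightarrow> (nat \<Rightarrow> real) \<Rightarrow> real" where
  "V_R2 r \<alpha> p q = V_T2 r \<alpha> p q / (S_alpha r \<alpha> p q)\<^sup>2"

text \<open>
  The normal law with mean \<open>\<mu>\<close> and variance \<open>v \<ge> 0\<close>. The second argument is the variance,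
  whereas \<^const>\<open>normal_density\<close> takes the standard deviation. Variance 0, which occurs as a
  limit when \<open>p = q\<close>, gives the point mass at \<open>\<mu>\<close>.
\<close>

definition normal_law :: "real \<Rightarrow> real \<Rightarrow> real measure" where
  "normal_law \<mu> v =
     (if v = 0 then return borel \<mu> else density lborel (normal_density \<mu> (sqrt v)))"

definition conv_in_distr :: "'w measure \<Rightarrow> (nat \<Rightarrow> 'w \<Rightarrow> real) \<Rightarrow> real measure \<Rightarrow> bool" where
  "conv_in_distr M Z L \<longleftrightarrow> weak_conv_m (\<lambda>k. distr M borel (Z k)) L"

end

(*
  Delta method. Near (p, q) the divergence differs from its linearisation by o(d), where d is the l1
  distance of the mass vectors. By Bienayme's identity, E d = O(1 / sqrt n) for empirical masses, so
  after scaling the remainder tends to 0 in probability (Markov), and by Slutsky only the linear part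
  matters. The linear part is a sum of independent, centred, uniformly small terms, so its
  characteristic function is within a Taylor error of that of the normal law with the same variance,
  and Levy's theorem applies. Working with triangular arrays covers both samples at once, and also
  degenerate variances, since no division by the variance occurs.
*)

theory Submission imports Defs begin

section \<open>Limits in distribution\<close>

text \<open>Vanishing empirical masses need no case distinction: the estimate of the remainder is
  deterministic and local at (p, q), and the event that d leaves its radius of validity is absorbed
  by Markov's inequality. The values of \<open>powr\<close> and \<open>ln\<close> at 0 therefore
  never reach the limit. Convergence of d to 0 alone would not do, because the remainder is
  multiplied by a scale N tending to infinity; a bound on N times E d, uniform along the sequence,
  makes N cancel. In the Taylor step, each error carries the variance of its own summand as a
  factor. The errors thus add up to the total variance times a null sequence, however many summands
  a row has. The limiting variance arises as the variance, under the true masses, of the gradient of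
  the divergence evaluated at one observation; separate algebra identifies it with
  \<open>V_R1\<close> and \<open>V_R2\<close>.\<close>

context prob_space
begin

text \<open>Products of complex numbers of modulus at most 1 differ by at most the sum of the
  differences of their factors. Each factor is compared with a Gaussian one at a cost proportional
  to the variance of its summand, so only the total variance \<open>v\<close> enters, not the number
  of summands.\<close>

lemma char_sum_bounded_indep:
  fixes W :: "'i \<Rightarrow> 'a \<Rightarrow> real"
  assumes indep: "indep_vars (\<lambda>_. borel) W A"
    and bound: "\<And>i \<omega>. i \<in> A \<Longrightarrow> \<omega> \<in> space M \<Longrightarrow> \<bar>W i \<omega>\<bar> \<le> b"
    and mean: "\<And>i. i \<in> A \<Longrightarrow> expectation (W i) = 0"
  defines "v \<equiv> (\<Sum>i\<in>A. expectation (\<lambda>\<omega>. (W i \<omega>)\<^sup>2))"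
  shows "cmod (char (distr M borel (\<lambda>\<omega>. \<Sum>i\<in>A. W i \<omega>)) t - exp (- (v * t\<^sup>2 / 2)))
    \<le> v * (\<bar>t\<bar> ^ 3 * b / 6 + b\<^sup>2 * t ^ 4 / 8)"
proof (cases "finite A")
  \<comment> \<open>Sums over an infinite set are 0, so the bound reads 0 on both sides.\<close>
  case False
  then show ?thesis
    by (simp add: v_def char_def integral_distr prob_space del: distr_const)
next
  case True
  define s where "s i = expectation (\<lambda>\<omega>. (W i \<omega>)\<^sup>2)" for i
  define \<phi> where "\<phi> i = char (distr M borel (W i)) t" for i
  have rv [measurable]: "random_variable borel (W i)" if "i \<in> A" for i
    using indep that by (auto simp: indep_vars_def)
  have s_nonneg: "0 \<le> s i" for i
    by (simp add: s_def)
  have step: "cmod (\<phi> i - of_real (exp (- (s i * t\<^sup>2 / 2)))) \<le> s i * (\<bar>t\<bar> ^ 3 * b / 6 + b\<^sup>2 * t ^ 4 / 8)"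
    if i: "i \<in> A" for i
  proof -
    note [measurable] = rv[OF i]
    have b: "0 \<le> b"
      using bound[OF i] not_empty by force
    have sq_le: "(W i \<omega>)\<^sup>2 \<le> b\<^sup>2" if "\<omega> \<in> space M" for \<omega>
      using bound[OF i that] by (simp add: abs_le_square_iff[symmetric] b)
    have int1: "integrable M (W i)"
      by (rule integrable_const_bound[where B = b]) (use bound[OF i] in auto)
    have int2: "integrable M (\<lambda>\<omega>. (W i \<omega>)\<^sup>2)"
      by (rule integrable_const_bound[where B = "b\<^sup>2"]) (use sq_le in auto)
    have s_le: "s i \<le> b\<^sup>2"
      unfolding s_def by (rule integral_le_const[OF int2]) (use sq_le in auto)
    have "cmod (\<phi> i - (1 - t\<^sup>2 * s i / 2))
        \<le> (t\<^sup>2 / 6) * expectation (\<lambda>\<omega>. min (6 * (W i \<omega>)\<^sup>2) (\<bar>t\<bar> * \<bar>W i \<omega>\<bar> ^ 3))"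
      unfolding \<phi>_def
      by (rule char_approx3'[OF _ int1 int2]) (use mean[OF i] in \<open>auto simp: s_def\<close>)
    \<comment> \<open>Of the two terms in the minimum the cubic one is kept; one factor of the cube
      is spent on \<open>b\<close>, which leaves a full second moment.\<close>
    also have "\<dots> \<le> (t\<^sup>2 / 6) * expectation (\<lambda>\<omega>. \<bar>t\<bar> * b * (W i \<omega>)\<^sup>2)"
    proof (intro mult_left_mono integral_mono)
      show "integrable M (\<lambda>\<omega>. min (6 * (W i \<omega>)\<^sup>2) (\<bar>t\<bar> * \<bar>W i \<omega>\<bar> ^ 3))"
        by (rule Bochner_Integration.integrable_bound[where f = "\<lambda>\<omega>. 6 * (W i \<omega>)\<^sup>2"]) (use int2 in auto)
      fix \<omega> assume "\<omega> \<in> space M"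
      then have "\<bar>W i \<omega>\<bar> * (W i \<omega>)\<^sup>2 \<le> b * (W i \<omega>)\<^sup>2"
        using bound[OF i] by (intro mult_right_mono) auto
      moreover have "\<bar>W i \<omega>\<bar> ^ 3 = \<bar>W i \<omega>\<bar> * (W i \<omega>)\<^sup>2"
        by (simp add: power3_eq_cube power2_eq_square)
      ultimately have "\<bar>t\<bar> * \<bar>W i \<omega>\<bar> ^ 3 \<le> \<bar>t\<bar> * (b * (W i \<omega>)\<^sup>2)"
        by (intro mult_left_mono) auto
      then show "min (6 * (W i \<omega>)\<^sup>2) (\<bar>t\<bar> * \<bar>W i \<omega>\<bar> ^ 3) \<le> \<bar>t\<bar> * b * (W i \<omega>)\<^sup>2"
        by simp
    qed (use int2 in auto)
    also have "\<dots> = s i * (\<bar>t\<bar> ^ 3 * b / 6)"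
      by (simp add: s_def power3_eq_cube power2_eq_square)
    finally have 1: "cmod (\<phi> i - (1 - t\<^sup>2 * s i / 2)) \<le> s i * (\<bar>t\<bar> ^ 3 * b / 6)" .
    define x where "x = s i * t\<^sup>2 / 2"
    have x: "0 \<le> x"
      by (simp add: x_def s_nonneg)
    have "\<bar>(1 - x) - exp (- x)\<bar> \<le> x\<^sup>2 / 2"
    proof -
      have "1 - x \<le> exp (- x)"
        using exp_ge_add_one_self[of "- x"] by simp
      moreover have "exp (- x) \<le> 1 - x + x\<^sup>2 / 2"
      proof -
        have "1 + x + x\<^sup>2 / 2 \<le> exp x"
          by (rule exp_lower_Taylor_quadratic[OF x])
        then have "inverse (exp x) \<le> inverse (1 + x + x\<^sup>2 / 2)"
          by (intro le_imp_inverse_le) (use x in \<open>auto intro!: add_pos_nonneg\<close>)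
        \<comment> \<open>The product of the two quadratics is 1 + x^4/4, hence at least 1.\<close>
        also have "\<dots> \<le> 1 - x + x\<^sup>2 / 2"
        proof -
          have "1 + x + x\<^sup>2 / 2 > 0"
            using x by (auto intro!: add_pos_nonneg)
          moreover have "(1 - x + x\<^sup>2 / 2) * (1 + x + x\<^sup>2 / 2) = 1 + (x ^ 2)\<^sup>2 / 4"
            by (simp add: field_simps power2_eq_square)
          ultimately show ?thesis
            by (simp add: inverse_eq_divide pos_divide_le_eq)
        qed
        finally show ?thesis
          by (simp add: exp_minus)
      qed
      ultimately show ?thesis
        by simp
    qed
    also have "x\<^sup>2 / 2 = s i * (s i * t ^ 4 / 8)"
      by (simp add: x_def power2_eq_square power4_eq_xxxx)
    \<comment> \<open>Only one of the two factors \<open>s i\<close> is replaced by its bound; the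
      other is kept so that the errors sum to a multiple of \<open>v\<close>.\<close>
    also have "\<dots> \<le> s i * (b\<^sup>2 * t ^ 4 / 8)"
      by (intro mult_left_mono divide_right_mono mult_right_mono s_le s_nonneg) auto
    finally have "\<bar>(1 - x) - exp (- x)\<bar> \<le> s i * (b\<^sup>2 * t ^ 4 / 8)" .
    moreover have "cmod ((1 - t\<^sup>2 * s i / 2) - of_real (exp (- (s i * t\<^sup>2 / 2)))) = \<bar>(1 - x) - exp (- x)\<bar>"
      unfolding x_def
      by (subst norm_of_real[symmetric, where 'a = complex]) (simp add: mult.commute)
    ultimately have 2: "cmod ((1 - t\<^sup>2 * s i / 2) - of_real (exp (- (s i * t\<^sup>2 / 2))))
        \<le> s i * (b\<^sup>2 * t ^ 4 / 8)"
      by simp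
    show ?thesis
      using norm_triangle_le[OF add_mono[OF 1 2]] by (simp add: distrib_left)
  qed
  have "of_real (exp (- (v * t\<^sup>2 / 2))) = (\<Prod>i\<in>A. complex_of_real (exp (- (s i * t\<^sup>2 / 2))))"
    using True
    by (simp add: exp_sum[symmetric] v_def s_def sum_negf sum_divide_distrib sum_distrib_right
        del: of_real_exp flip: of_real_prod)
  then have "cmod (char (distr M borel (\<lambda>\<omega>. \<Sum>i\<in>A. W i \<omega>)) t - exp (- (v * t\<^sup>2 / 2)))
      = cmod ((\<Prod>i\<in>A. \<phi> i) - (\<Prod>i\<in>A. complex_of_real (exp (- (s i * t\<^sup>2 / 2)))))"
    using char_distr_sum[OF indep, of t] by (simp add: \<phi>_def)
  also have "\<dots> \<le> (\<Sum>i\<in>A. cmod (\<phi> i - of_real (exp (- (s i * t\<^sup>2 / 2)))))"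
    by (intro norm_prod_diff)
      (auto simp: \<phi>_def s_nonneg norm_exp_eq_Re simp del: of_real_exp
        intro!: real_distribution.cmod_char_le_1 real_distribution_distr)
  also have "\<dots> \<le> (\<Sum>i\<in>A. s i * (\<bar>t\<bar> ^ 3 * b / 6 + b\<^sup>2 * t ^ 4 / 8))"
    by (intro sum_mono step)
  also have "\<dots> = v * (\<bar>t\<bar> ^ 3 * b / 6 + b\<^sup>2 * t ^ 4 / 8)"
    by (simp add: v_def s_def sum_distrib_right)
  finally show ?thesis .
qed

text \<open>Cross terms vanish by independence and centring. Integrability is carried through the
  same induction, because the product rule for expectations needs an integrable partial sum.\<close>

lemma second_moment_sum_indep:
  fixes W :: "'i \<Rightarrow> 'a \<Rightarrow> real"
  assumes "finite A" "indep_vars (\<lambda>_. borel) W A"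
    and "\<And>i. i \<in> A \<Longrightarrow> integrable M (\<lambda>\<omega>. (W i \<omega>)\<^sup>2)"
    and "\<And>i. i \<in> A \<Longrightarrow> expectation (W i) = 0"
  shows "integrable M (\<lambda>\<omega>. (\<Sum>i\<in>A. W i \<omega>)\<^sup>2)"
    and "expectation (\<lambda>\<omega>. (\<Sum>i\<in>A. W i \<omega>)\<^sup>2) = (\<Sum>i\<in>A. expectation (\<lambda>\<omega>. (W i \<omega>)\<^sup>2))"
proof -
  have "integrable M (\<lambda>\<omega>. (\<Sum>i\<in>A. W i \<omega>)\<^sup>2) \<and>
      expectation (\<lambda>\<omega>. (\<Sum>i\<in>A. W i \<omega>)\<^sup>2) = (\<Sum>i\<in>A. expectation (\<lambda>\<omega>. (W i \<omega>)\<^sup>2))"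
    using assms
  proof (induction A rule: finite_induct)
    case (insert i A)
    let ?S = "\<lambda>\<omega>. \<Sum>i\<in>A. W i \<omega>"
    have rv: "random_variable borel (W j)" if "j \<in> insert i A" for j
      using insert.prems(1) that by (auto simp: indep_vars_def)
    have [measurable]: "random_variable borel (W i)" "random_variable borel ?S"
      using rv by auto
    have IH: "integrable M (\<lambda>\<omega>. (?S \<omega>)\<^sup>2)"
        "expectation (\<lambda>\<omega>. (?S \<omega>)\<^sup>2) = (\<Sum>i\<in>A. expectation (\<lambda>\<omega>. (W i \<omega>)\<^sup>2))"
      using insert.IH[OF indep_vars_subset[OF insert.prems(1)]] insert.prems by auto
    have sq: "integrable M (\<lambda>\<omega>. (W i \<omega>)\<^sup>2)"
      using insert.prems by simp
    have int: "integrable M (W i)" "integrable M ?S"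
      by (rule square_integrable_imp_integrable, measurable, rule sq)
        (rule square_integrable_imp_integrable, measurable, rule IH)
    have ind: "indep_var borel (W i) borel ?S"
      by (rule indep_vars_sum[OF insert.hyps insert.prems(1)])
    have cross: "integrable M (\<lambda>\<omega>. W i \<omega> * ?S \<omega>)" "expectation (\<lambda>\<omega>. W i \<omega> * ?S \<omega>) = 0"
      using indep_var_integrable[OF ind int] indep_var_lebesgue_integral[OF ind int] insert.prems
      by simp_all
    have eq: "(\<Sum>i\<in>insert i A. W i \<omega>)\<^sup>2 = (W i \<omega>)\<^sup>2 + (?S \<omega>)\<^sup>2 + 2 * (W i \<omega> * ?S \<omega>)" for \<omega>
      using insert.hyps by (simp add: power2_sum)
    show ?case
      unfolding eq using insert.hyps IH sq cross by simp
  qed simp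
  then show "integrable M (\<lambda>\<omega>. (\<Sum>i\<in>A. W i \<omega>)\<^sup>2)"
    and "expectation (\<lambda>\<omega>. (\<Sum>i\<in>A. W i \<omega>)\<^sup>2) = (\<Sum>i\<in>A. expectation (\<lambda>\<omega>. (W i \<omega>)\<^sup>2))"
    by blast+
qed

end

section \<open>Normal laws, including the degenerate one\<close>

lemma real_distribution_normal_law: "0 \<le> v \<Longrightarrow> real_distribution (normal_law \<mu> v)"
  using prob_space_normal_density[of "sqrt v" \<mu>]
  by (auto simp: normal_law_def real_distribution_def real_distribution_axioms_def prob_space_return)

text \<open>Positive variance reduces to the standard normal law by scaling. That the point mass
  obeys the same formula is what lets degenerate limits share the general argument.\<close>

lemma char_normal_law:
  assumes "0 \<le> v"
  shows "char (normal_law 0 v) t = exp (- (v * t\<^sup>2 / 2))"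
proof (cases "v = 0")
  case True
  then show ?thesis
    by (simp add: normal_law_def char_def integral_return)
next
  case False
  interpret N: prob_space std_normal_distribution
    by (rule prob_space_normal_density) simp
  have "distributed std_normal_distribution lborel (\<lambda>x. x) std_normal_density"
    by (auto simp: distributed_def distr_id2)
  from N.normal_density_affine[OF this, of "sqrt v" 0]
  have "distr std_normal_distribution lborel (\<lambda>x. sqrt v * x) = normal_law 0 v"
    using False assms by (simp add: distributed_def normal_law_def)
  then have "char (normal_law 0 v) t = char (distr std_normal_distribution borel (\<lambda>x. sqrt v * x)) t"
    by (metis distr_cong sets_lborel)
  also have "\<dots> = char std_normal_distribution (t * sqrt v)"
    by (simp add: char_def integral_distr ac_simps)
  also have "\<dots> = exp (- (v * t\<^sup>2 / 2))"
    using assms by (simp add: char_std_normal_distribution power_mult_distrib mult.commute)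
  finally show ?thesis .
qed

section \<open>Triangular arrays and negligible perturbations\<close>

context prob_space
begin

text \<open>A uniform bound \<open>b k\<close> tending to 0 takes the place of Lindeberg's
  condition: the error of row \<open>k\<close> is its variance sum, which converges, times a null
  sequence. The index type is arbitrary, so one row can mix observations of both samples.\<close>

theorem conv_in_distr_bounded_triangular_array:
  fixes W :: "nat \<Rightarrow> 'i \<Rightarrow> 'a \<Rightarrow> real"
  assumes indep: "\<And>k. indep_vars (\<lambda>_. borel) (W k) (A k)"
    and bound: "\<And>k i \<omega>. i \<in> A k \<Longrightarrow> \<omega> \<in> space M \<Longrightarrow> \<bar>W k i \<omega>\<bar> \<le> b k"
    and mean: "\<And>k i. i \<in> A k \<Longrightarrow> expectation (W k i) = 0"
    and var: "(\<lambda>k. \<Sum>i\<in>A k. expectation (\<lambda>\<omega>. (W k i \<omega>)\<^sup>2)) \<longlonglongrightarrow> v"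
    and b: "b \<longlonglongrightarrow> 0"
  shows "conv_in_distr M (\<lambda>k \<omega>. \<Sum>i\<in>A k. W k i \<omega>) (normal_law 0 v)"
proof -
  define s where "s k = (\<Sum>i\<in>A k. expectation (\<lambda>\<omega>. (W k i \<omega>)\<^sup>2))" for k
  have v: "0 \<le> v"
    using var by (rule LIMSEQ_le_const) (auto intro!: sum_nonneg)
  have rv [measurable]: "random_variable borel (\<lambda>\<omega>. \<Sum>i\<in>A k. W k i \<omega>)" for k
    using indep[of k] by (intro borel_measurable_sum) (auto simp: indep_vars_def)
  show ?thesis
    unfolding conv_in_distr_def
  proof (rule levy_continuity)
    show "real_distribution (normal_law 0 v)"
      by (rule real_distribution_normal_law[OF v])
    show "real_distribution (distr M borel (\<lambda>\<omega>. \<Sum>i\<in>A k. W k i \<omega>))" for k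
      by simp
    fix t
    have lim: "(\<lambda>k. s k * (\<bar>t\<bar> ^ 3 * b k / 6 + (b k)\<^sup>2 * t ^ 4 / 8)) \<longlonglongrightarrow> 0"
      using var b unfolding s_def by (auto intro!: tendsto_eq_intros)
    have "(\<lambda>k. char (distr M borel (\<lambda>\<omega>. \<Sum>i\<in>A k. W k i \<omega>)) t - exp (- (s k * t\<^sup>2 / 2))) \<longlonglongrightarrow> 0"
      by (rule Lim_null_comparison[OF _ lim], rule always_eventually)
        (unfold s_def, intro allI char_sum_bounded_indep indep bound mean)
    moreover have "(\<lambda>k. complex_of_real (exp (- (s k * t\<^sup>2 / 2)))) \<longlonglongrightarrow> exp (- (v * t\<^sup>2 / 2))"
      using var unfolding s_def by (intro tendsto_intros) auto
    ultimately show "(\<lambda>k. char (distr M borel (\<lambda>\<omega>. \<Sum>i\<in>A k. W k i \<omega>)) t) \<longlonglongrightarrow> char (normal_law 0 v) t"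
      unfolding char_normal_law[OF v] by (rule Lim_transform[rotated])
  qed
qed

text \<open>By the triangle inequality and the Lipschitz bound, the two exponentials differ by at
  most the minimum of 2 and |t| times the difference of the variables. This is small off an event of
  small probability, so the characteristic functions have the same limit.\<close>

theorem slutsky:
  assumes conv: "conv_in_distr M Z L" and L: "real_distribution L"
    and [measurable]: "\<And>k. random_variable borel (Z k)" "\<And>k. random_variable borel (Z' k)"
    and diff: "\<And>\<epsilon>. 0 < \<epsilon> \<Longrightarrow> (\<lambda>k. prob {\<omega> \<in> space M. \<epsilon> < \<bar>Z' k \<omega> - Z k \<omega>\<bar>}) \<longlonglongrightarrow> 0"
  shows "conv_in_distr M Z' L"
  unfolding conv_in_distr_def
proof (rule levy_continuity[OF _ L])
  show "real_distribution (distr M borel (Z' k))" for k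
    by simp
  fix t
  have "(\<lambda>k. char (distr M borel (Z k)) t) \<longlonglongrightarrow> char L t"
    using conv unfolding conv_in_distr_def by (intro levy_continuity1 L) auto
  moreover have "(\<lambda>k. char (distr M borel (Z' k)) t - char (distr M borel (Z k)) t) \<longlonglongrightarrow> 0"
  proof (rule tendstoI)
    fix e :: real
    assume e: "0 < e"
    \<comment> \<open>Off the exceptional event this leaves e/2; the event itself, of probability
      below e/4, adds less than 2 times e/4. The summand 1 keeps the denominator positive at
      \<open>t = 0\<close>.\<close>
    define \<epsilon> where "\<epsilon> = e / (2 * (\<bar>t\<bar> + 1))"
    have \<epsilon>: "0 < \<epsilon>" "\<bar>t\<bar> * \<epsilon> \<le> e / 2"
      using e by (auto simp: \<epsilon>_def field_simps)
    have "\<forall>\<^sub>F k in sequentially. prob {\<omega> \<in> space M. \<epsilon> < \<bar>Z' k \<omega> - Z k \<omega>\<bar>} < e / 4"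
      using order_tendstoD(2)[OF diff[OF \<epsilon>(1)], of "e / 4"] e by simp
    then show "\<forall>\<^sub>F k in sequentially.
        dist (char (distr M borel (Z' k)) t - char (distr M borel (Z k)) t) 0 < e"
    proof eventually_elim
      case (elim k)
      let ?B = "{\<omega> \<in> space M. \<epsilon> < \<bar>Z' k \<omega> - Z k \<omega>\<bar>}"
      have int: "integrable M (\<lambda>\<omega>. iexp (t * Z' k \<omega>))" "integrable M (\<lambda>\<omega>. iexp (t * Z k \<omega>))"
        by (auto intro!: integrable_const_bound[where B = 1])
      have "cmod (char (distr M borel (Z' k)) t - char (distr M borel (Z k)) t)
          = cmod (expectation (\<lambda>\<omega>. iexp (t * Z' k \<omega>) - iexp (t * Z k \<omega>)))"
        using int by (simp add: char_def integral_distr)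
      also have "\<dots> \<le> expectation (\<lambda>\<omega>. cmod (iexp (t * Z' k \<omega>) - iexp (t * Z k \<omega>)))"
        by (rule integral_norm_bound)
      also have "\<dots> \<le> expectation (\<lambda>\<omega>. e / 2 + 2 * indicat_real ?B \<omega>)"
      proof (rule integral_mono)
        fix \<omega>
        assume \<omega>: "\<omega> \<in> space M"
        have "cmod (iexp (t * Z' k \<omega>) - iexp (t * Z k \<omega>))
            = cmod (iexp (t * Z k \<omega>)) * cmod (iexp (t * (Z' k \<omega> - Z k \<omega>)) - 1)"
          unfolding norm_mult[symmetric] by (simp add: algebra_simps flip: exp_add)
        then have eq: "cmod (iexp (t * Z' k \<omega>) - iexp (t * Z k \<omega>)) = cmod (iexp (t * (Z' k \<omega> - Z k \<omega>)) - 1)"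
          by simp
        have "cmod (iexp (t * (Z' k \<omega> - Z k \<omega>)) - 1) \<le> \<bar>t * (Z' k \<omega> - Z k \<omega>)\<bar>"
          using iexp_approx1[of "t * (Z' k \<omega> - Z k \<omega>)" 0] by simp
        moreover have "cmod (iexp (t * (Z' k \<omega> - Z k \<omega>)) - 1) \<le> 2"
          using norm_triangle_ineq4[of "iexp (t * (Z' k \<omega> - Z k \<omega>))" 1] by simp
        moreover have "\<bar>t * (Z' k \<omega> - Z k \<omega>)\<bar> \<le> e / 2" if "\<omega> \<notin> ?B"
        proof -
          have "\<bar>t\<bar> * \<bar>Z' k \<omega> - Z k \<omega>\<bar> \<le> \<bar>t\<bar> * \<epsilon>"
            using that \<omega> by (intro mult_left_mono) auto
          then show ?thesis
            using \<epsilon>(2) by (simp add: abs_mult)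
        qed
        ultimately show "cmod (iexp (t * Z' k \<omega>) - iexp (t * Z k \<omega>)) \<le> e / 2 + 2 * indicat_real ?B \<omega>"
          unfolding eq using e by (cases "\<omega> \<in> ?B") auto
      qed (use int in \<open>auto simp: less_top[symmetric]\<close>)
      also have "\<dots> = e / 2 + 2 * prob ?B"
        by (subst Bochner_Integration.integral_add) (auto simp: less_top[symmetric] prob_space)
      also have "\<dots> < e"
        using elim by simp
      finally show ?case
        by simp
    qed
  qed
  ultimately show "(\<lambda>k. char (distr M borel (Z' k)) t) \<longlonglongrightarrow> char L t"
    by (rule Lim_transform)
qed

text \<open>If the scaled remainder exceeds \<open>\<eta>\<close>, then \<open>D k\<close> is either
  at least \<open>\<delta>\<close> or at least \<open>\<eta> / (N k * \<epsilon>)\<close>. Markov's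
  inequality bounds the first probability by a multiple of 1/N. In the second, N cancels and a
  multiple of \<open>\<epsilon>\<close> remains, which is free to be small.\<close>

lemma delta_remainder_tendsto_0:
  fixes D R :: "nat \<Rightarrow> 'a \<Rightarrow> real"
  assumes N: "filterlim N at_top sequentially"
    and [measurable]: "\<And>k. random_variable borel (R k)"
    and int: "\<And>k. integrable M (D k)"
    and nonneg: "\<And>k \<omega>. \<omega> \<in> space M \<Longrightarrow> 0 \<le> D k \<omega>"
    and tight: "\<And>k. N k * expectation (D k) \<le> C"
    and small: "\<And>\<epsilon>. 0 < \<epsilon> \<Longrightarrow> \<exists>\<delta>>0. \<forall>k. \<forall>\<omega>\<in>space M. D k \<omega> < \<delta> \<longrightarrow> \<bar>R k \<omega>\<bar> \<le> \<epsilon> * D k \<omega>"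
    and \<eta>: "0 < \<eta>"
  shows "(\<lambda>k. prob {\<omega> \<in> space M. \<eta> < \<bar>N k * R k \<omega>\<bar>}) \<longlonglongrightarrow> 0"
proof (rule tendstoI)
  have [measurable]: "random_variable borel (D k)" for k
    using int by simp
  fix e :: real
  assume e: "0 < e"
  define C' where "C' = max C 1"
  have C': "0 < C'" and tight': "N k * expectation (D k) \<le> C'" for k
    using tight[of k] by (auto simp: C'_def)
  \<comment> \<open>Chosen so that the second Markov bound is exactly e/4, whatever
    \<open>N k\<close> is.\<close>
  define \<epsilon> where "\<epsilon> = e * \<eta> / (4 * C')"
  have \<epsilon>: "0 < \<epsilon>"
    using e \<eta> C' by (simp add: \<epsilon>_def)
  obtain \<delta> where \<delta>: "0 < \<delta>"
    and R: "\<And>k \<omega>. \<omega> \<in> space M \<Longrightarrow> D k \<omega> < \<delta> \<Longrightarrow> \<bar>R k \<omega>\<bar> \<le> \<epsilon> * D k \<omega>"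
    using small[OF \<epsilon>] by blast
  \<comment> \<open>Beyond this threshold the first Markov bound is below e/4.\<close>
  have "\<forall>\<^sub>F k in sequentially. 4 * C' / (e * \<delta>) < N k" "\<forall>\<^sub>F k in sequentially. 0 < N k"
    using N by (auto simp: filterlim_at_top_dense)
  then show "\<forall>\<^sub>F k in sequentially. dist (prob {\<omega> \<in> space M. \<eta> < \<bar>N k * R k \<omega>\<bar>}) 0 < e"
  proof eventually_elim
    case (elim k)
    have mean: "expectation (D k) \<le> C' / N k"
      using tight'[of k] elim by (simp add: field_simps)
    have "{\<omega> \<in> space M. \<eta> < \<bar>N k * R k \<omega>\<bar>}
        \<subseteq> {\<omega> \<in> space M. \<delta> \<le> D k \<omega>} \<union> {\<omega> \<in> space M. \<eta> / (N k * \<epsilon>) \<le> D k \<omega>}"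
    proof safe
      fix \<omega>
      assume \<omega>: "\<omega> \<in> space M" "\<eta> < \<bar>N k * R k \<omega>\<bar>" "\<not> \<eta> / (N k * \<epsilon>) \<le> D k \<omega>"
      show "\<delta> \<le> D k \<omega>"
      proof (rule ccontr)
        assume "\<not> \<delta> \<le> D k \<omega>"
        then have "N k * \<bar>R k \<omega>\<bar> \<le> N k * (\<epsilon> * D k \<omega>)"
          using R[OF \<omega>(1)] elim by (intro mult_left_mono) auto
        moreover have "D k \<omega> * (N k * \<epsilon>) < \<eta>"
          using \<omega>(3) elim \<epsilon> by (simp add: not_le field_simps)
        ultimately show False
          using \<omega>(2) elim unfolding abs_mult by (smt (verit) mult.assoc mult.commute)
      qed
    qed
    then have "prob {\<omega> \<in> space M. \<eta> < \<bar>N k * R k \<omega>\<bar>}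
        \<le> prob ({\<omega> \<in> space M. \<delta> \<le> D k \<omega>} \<union> {\<omega> \<in> space M. \<eta> / (N k * \<epsilon>) \<le> D k \<omega>})"
      by (intro finite_measure_mono) auto
    also have "\<dots> \<le> prob {\<omega> \<in> space M. \<delta> \<le> D k \<omega>} + prob {\<omega> \<in> space M. \<eta> / (N k * \<epsilon>) \<le> D k \<omega>}"
      by (intro measure_Un_le) auto
    also have "\<dots> \<le> expectation (D k) / \<delta> + expectation (D k) / (\<eta> / (N k * \<epsilon>))"
      using \<delta> \<eta> \<epsilon> elim nonneg
      by (intro add_mono integral_Markov_inequality_measure[where A = "space M" and u = "D k", simplified] int)
         auto
    also have "\<dots> \<le> C' / N k / \<delta> + C' / N k / (\<eta> / (N k * \<epsilon>))"
      using mean \<delta> \<eta> \<epsilon> elim by (intro add_mono divide_right_mono) auto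
    also have "C' / N k / (\<eta> / (N k * \<epsilon>)) = e / 4"
      using elim \<eta> C' by (simp add: \<epsilon>_def)
    also have "C' / N k / \<delta> < e / 4"
      using elim e \<delta> by (simp add: field_simps)
    finally show ?case
      using e by simp
  qed
qed

end

section \<open>The variance and the differential of the divergence\<close>

lemma sum_square_real:
  fixes u :: "nat \<Rightarrow> real"
  shows "(\<Sum>j=1..r. u j)\<^sup>2 = (\<Sum>j=1..r. (u j)\<^sup>2)
    + 2 * (\<Sum>(i, j) \<in> {(i, j) \<in> {1..r} \<times> {1..r}. i < j}. u i * u j)"
proof -
  define L where "L = {(i, j) \<in> {1..r} \<times> {1..r}. i < j}"
  define G where "G = {(i, j) \<in> {1..r} \<times> {1..r}. j < i}"
  define E where "E = (\<lambda>j. (j, j)) ` {1..r}"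
  have fin: "finite L" "finite G" "finite E"
    by (auto simp: E_def L_def G_def intro: finite_subset[of _ "{1..r} \<times> {1..r}"])
  have un: "{1..r} \<times> {1..r} = E \<union> (L \<union> G)" "L \<inter> G = {}" "E \<inter> (L \<union> G) = {}"
    by (auto simp: E_def L_def G_def)
  have "(\<Sum>j=1..r. u j)\<^sup>2 = (\<Sum>(i, j) \<in> {1..r} \<times> {1..r}. u i * u j)"
    by (simp add: power2_eq_square sum_product sum.cartesian_product)
  also have "\<dots> = (\<Sum>(i, j) \<in> E. u i * u j) + ((\<Sum>(i, j) \<in> L. u i * u j) + (\<Sum>(i, j) \<in> G. u i * u j))"
    using fin un by (simp add: sum.union_disjoint)
  also have "(\<Sum>(i, j) \<in> G. u i * u j) = (\<Sum>(i, j) \<in> L. u i * u j)"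
    by (rule sum.reindex_bij_witness[where i = prod.swap and j = prod.swap])
      (auto simp: L_def G_def)
  also have "(\<Sum>(i, j) \<in> E. u i * u j) = (\<Sum>j=1..r. (u j)\<^sup>2)"
    unfolding E_def by (subst sum.reindex) (auto simp: inj_on_def power2_eq_square)
  finally show ?thesis
    by (simp add: L_def)
qed

text \<open>Partial derivatives of \<^const>\<open>renyi_div\<close> in \<open>p j\<close> and in \<open>q j\<close>.\<close>

definition grad_p :: "nat \<Rightarrow> real \<Rightarrow> (nat \<Rightarrow> real) \<Rightarrow> (nat \<Rightarrow> real) \<Rightarrow> nat \<Rightarrow> real" where
  "grad_p r \<alpha> p q j = \<alpha> / (\<alpha> - 1) * (p j / q j) powr (\<alpha> - 1) / S_alpha r \<alpha> p q"

definition grad_q :: "nat \<Rightarrow> real \<Rightarrow> (nat \<Rightarrow> real) \<Rightarrow> (nat \<Rightarrow> real) \<Rightarrow> nat \<Rightarrow> real" where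
  "grad_q r \<alpha> p q j = - ((p j / q j) powr \<alpha>) / S_alpha r \<alpha> p q"

text \<open>When the masses \<open>p\<close> sum to 1, this is the variance of \<open>a J\<close>
  for a random index \<open>J\<close> of law \<open>p\<close>, written as second moment minus
  squared mean.\<close>

definition multinomial_var :: "nat \<Rightarrow> (nat \<Rightarrow> real) \<Rightarrow> (nat \<Rightarrow> real) \<Rightarrow> real" where
  "multinomial_var r p a = (\<Sum>j=1..r. (a j)\<^sup>2 * p j) - (\<Sum>j=1..r. a j * p j)\<^sup>2"

text \<open>The diagonal of the squared mean turns the weight \<open>p j\<close> into
  \<open>p j * (1 - p j)\<close>; the rest gives each unordered pair twice.\<close>

lemma multinomial_var_pairs:
  "multinomial_var r p a = (\<Sum>j=1..r. p j * (1 - p j) * (a j)\<^sup>2)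
    - 2 * (\<Sum>(i, j) \<in> {(i, j) \<in> {1..r} \<times> {1..r}. i < j}. (a i * p i) * (a j * p j))"
  unfolding multinomial_var_def sum_square_real
  by (simp add: algebra_simps power2_eq_square sum_subtractf)

lemma multinomial_var_divide:
  "multinomial_var r p (\<lambda>j. k * a j / s) = k\<^sup>2 * multinomial_var r p a / s\<^sup>2"
proof -
  have "(\<Sum>j=1..r. (k * a j / s)\<^sup>2 * p j) = k\<^sup>2 * (\<Sum>j=1..r. (a j)\<^sup>2 * p j) / s\<^sup>2"
    by (simp add: sum_distrib_left sum_divide_distrib power_mult_distrib power_divide ac_simps)
  moreover have "(\<Sum>j=1..r. k * a j / s * p j) = k * (\<Sum>j=1..r. a j * p j) / s"
    by (simp add: sum_distrib_left sum_divide_distrib ac_simps)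
  ultimately show ?thesis
    by (simp add: multinomial_var_def power_mult_distrib power_divide algebra_simps diff_divide_distrib)
qed

text \<open>The constant factor and \<open>S_alpha\<close> leave the gradient by homogeneity and
  account for the prefactors of \<open>V_R1\<close>. Multiplying a weight by its mass gives
  p^\<alpha> q^(1-\<alpha>), which is the common shape of the cross terms in both variances.\<close>

lemma V_R1_eq:
  assumes "\<And>j. j \<in> {1..r} \<Longrightarrow> p j > 0" "\<And>j. j \<in> {1..r} \<Longrightarrow> q j > 0"
  shows "V_R1 r \<alpha> p q = multinomial_var r p (grad_p r \<alpha> p q)"
proof -
  have a: "((p j / q j) powr (\<alpha> - 1))\<^sup>2 = (p j / q j) powr (2 * \<alpha> - 2)" for j
    by (simp add: power2_eq_square flip: powr_add)
  have b: "(p i / q i) powr (\<alpha> - 1) * p i * ((p j / q j) powr (\<alpha> - 1) * p j)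
      = (p i * p j) powr \<alpha> * (q i * q j) powr (1 - \<alpha>)" if "i \<in> {1..r}" "j \<in> {1..r}" for i j
  proof -
    have *: "(p i / q i) powr (\<alpha> - 1) * p i = p i powr \<alpha> * q i powr (1 - \<alpha>)" if "i \<in> {1..r}" for i
      using assms(1)[OF that] assms(2)[OF that]
      by (simp add: powr_divide powr_diff field_simps)
    show ?thesis
      using assms(1)[OF that(1)] assms(2)[OF that(1)] assms(1)[OF that(2)] assms(2)[OF that(2)]
      by (simp add: *[OF that(1)] *[OF that(2)] powr_mult)
  qed
  have "(\<Sum>(i, j) \<in> {(i, j) \<in> {1..r} \<times> {1..r}. i < j}. (p i * p j) powr \<alpha> * (q i * q j) powr (1 - \<alpha>))
    = (\<Sum>(i, j) \<in> {(i, j) \<in> {1..r} \<times> {1..r}. i < j}.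
        (p i / q i) powr (\<alpha> - 1) * p i * ((p j / q j) powr (\<alpha> - 1) * p j))"
    by (rule sum.cong[OF refl]) (auto simp: b)
  then show ?thesis
    unfolding grad_p_def[abs_def] multinomial_var_divide V_R1_def V_T1_def multinomial_var_pairs a by simp
qed

lemma V_R2_eq:
  assumes "\<And>j. j \<in> {1..r} \<Longrightarrow> p j > 0" "\<And>j. j \<in> {1..r} \<Longrightarrow> q j > 0"
  shows "V_R2 r \<alpha> p q = multinomial_var r q (grad_q r \<alpha> p q)"
proof -
  have a: "((p j / q j) powr \<alpha>)\<^sup>2 = (p j / q j) powr (2 * \<alpha>)" for j
    by (simp add: power2_eq_square flip: powr_add)
  have b: "(p i / q i) powr \<alpha> * q i * ((p j / q j) powr \<alpha> * q j)
      = (p i * p j) powr \<alpha> * (q i * q j) powr (1 - \<alpha>)" if "i \<in> {1..r}" "j \<in> {1..r}" for i j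
  proof -
    have *: "(p i / q i) powr \<alpha> * q i = p i powr \<alpha> * q i powr (1 - \<alpha>)" if "i \<in> {1..r}" for i
      using assms(1)[OF that] assms(2)[OF that]
      by (simp add: powr_divide powr_diff field_simps)
    show ?thesis
      using assms(1)[OF that(1)] assms(2)[OF that(1)] assms(1)[OF that(2)] assms(2)[OF that(2)]
      by (simp add: *[OF that(1)] *[OF that(2)] powr_mult)
  qed
  have "(\<Sum>(i, j) \<in> {(i, j) \<in> {1..r} \<times> {1..r}. i < j}. (p i * p j) powr \<alpha> * (q i * q j) powr (1 - \<alpha>))
    = (\<Sum>(i, j) \<in> {(i, j) \<in> {1..r} \<times> {1..r}. i < j}.
        (p i / q i) powr \<alpha> * q i * ((p j / q j) powr \<alpha> * q j))"
    by (rule sum.cong[OF refl]) (auto simp: b)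
  \<comment> \<open>The explicit factor -1 fits \<open>multinomial_var_divide\<close>; it disappears
    on squaring, which is why \<open>V_T2\<close> has no prefactor.\<close>
  moreover have g: "grad_q r \<alpha> p q = (\<lambda>j. - 1 * (p j / q j) powr \<alpha> / S_alpha r \<alpha> p q)"
    by (simp add: grad_q_def[abs_def])
  ultimately show ?thesis
    unfolding g multinomial_var_divide V_R2_def V_T2_def multinomial_var_pairs a by simp
qed

section \<open>Differentiability of the divergence\<close>

definition l1_dist :: "nat \<Rightarrow> (nat \<Rightarrow> real) \<Rightarrow> (nat \<Rightarrow> real) \<Rightarrow> real" where
  "l1_dist r x y = (\<Sum>j=1..r. \<bar>x j - y j\<bar>)"

lemma abs_diff_le_l1_dist: "j \<in> {1..r} \<Longrightarrow> \<bar>x j - y j\<bar> \<le> l1_dist r x y"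
  unfolding l1_dist_def by (rule member_le_sum) auto

lemma l1_dist_nonneg: "0 \<le> l1_dist r x y"
  unfolding l1_dist_def by (rule sum_nonneg) simp

text \<open>Restates a derivative along an arbitrary filter and against any majorant
  \<open>d\<close> of the increment, so that remainders of functions on different spaces can be
  compared with one common \<open>d\<close>.\<close>

lemma smallo_has_derivative:
  fixes f :: "'a::real_normed_vector \<Rightarrow> 'b::real_normed_vector"
  assumes f: "(f has_derivative f') (at x0)" and g: "filterlim g (nhds x0) F"
    and d: "\<And>z. norm (g z - x0) \<le> d z"
  shows "\<forall>\<epsilon>>0. \<forall>\<^sub>F z in F. norm (f (g z) - f x0 - f' (g z - x0)) \<le> \<epsilon> * d z"
proof (intro allI impI)
  fix \<epsilon> :: real
  assume \<epsilon>: "0 < \<epsilon>"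
  then obtain \<delta> where \<delta>: "0 < \<delta>"
    "\<And>y. norm (y - x0) < \<delta> \<Longrightarrow> norm (f y - f x0 - f' (y - x0)) \<le> \<epsilon> * norm (y - x0)"
    using f unfolding has_derivative_at_alt by blast
  have "\<forall>\<^sub>F z in F. dist (g z) x0 < \<delta>"
    using tendstoD[OF g \<delta>(1)] .
  then show "\<forall>\<^sub>F z in F. norm (f (g z) - f x0 - f' (g z - x0)) \<le> \<epsilon> * d z"
  proof eventually_elim
    case (elim z)
    then show ?case
      using \<delta>(2)[of "g z"] \<epsilon> d[of z]
      by (intro order_trans[OF _ mult_left_mono[OF d]]) (auto simp: dist_norm)
  qed
qed

text \<open>The chain rule in little-o form: a sum of functions of the pairs (p j, q j), followed by
  \<open>ln\<close> at a positive point. The radius \<open>\<delta>\<close> depends on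
  \<open>\<epsilon>\<close> but not on the vectors, which gives uniformity over the sample points
  and along the sequence.\<close>

lemma renyi_div_differentiable:
  assumes p: "\<And>j. j \<in> {1..r} \<Longrightarrow> p j > 0" and q: "\<And>j. j \<in> {1..r} \<Longrightarrow> q j > 0"
    and r: "1 \<le> r" and \<alpha>: "\<alpha> \<noteq> 1" and \<epsilon>: "0 < \<epsilon>"
  shows "\<exists>\<delta>>0. \<forall>x y. l1_dist r x p + l1_dist r y q < \<delta> \<longrightarrow>
    \<bar>renyi_div r \<alpha> x y - renyi_div r \<alpha> p q
      - ((\<Sum>j=1..r. grad_p r \<alpha> p q j * (x j - p j)) + (\<Sum>j=1..r. grad_q r \<alpha> p q j * (y j - q j)))\<bar>
    \<le> \<epsilon> * (l1_dist r x p + l1_dist r y q)"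
proof -
  (* Vectors of masses are functions on nat, which carry no norm: differentiability is expressed by
     the filter F of neighbourhoods of (p, q) in the l1 distance d on the first r coordinates. *)
  define d where "d z = l1_dist r (fst z) p + l1_dist r (snd z) q" for z
  define F where "F = filtercomap d (nhds 0)"
  have d_nonneg: "0 \<le> d z" for z
    by (simp add: d_def l1_dist_nonneg)
  have d_lim: "(d \<longlongrightarrow> 0) F"
    unfolding F_def by (rule filterlim_filtercomap)
  define h where "h = (\<lambda>z::real \<times> real. fst z powr \<alpha> * snd z powr (1 - \<alpha>))"
  \<comment> \<open>The differential of \<open>h\<close> at \<open>(p j, q j)\<close>, with the
    powers of both masses gathered into powers of the ratio, as in \<open>grad_p\<close> and
    \<open>grad_q\<close>.\<close>
  define D where "D j z = \<alpha> * (p j / q j) powr (\<alpha> - 1) * fst z + (1 - \<alpha>) * (p j / q j) powr \<alpha> * snd z"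
    for j and z :: "real \<times> real"
  define Sp where "Sp = S_alpha r \<alpha> p q"
  have Sp: "0 < Sp"
    unfolding Sp_def S_alpha_def using r by (intro sum_pos mult_pos_pos) (use p q in \<open>auto simp: less_le\<close>)
  define \<Delta> where "\<Delta> z = S_alpha r \<alpha> (fst z) (snd z) - Sp" for z
  define LS where "LS z = (\<Sum>j=1..r. D j (fst z j - p j, snd z j - q j))" for z
  have S_diff: "(\<lambda>z. \<Delta> z - LS z) \<in> o[F](d)"
  proof -
    have "(\<lambda>z. h (fst z j, snd z j) - h (p j, q j) - D j (fst z j - p j, snd z j - q j)) \<in> o[F](d)"
      if j: "j \<in> {1..r}" for j
    proof (rule landau_o.smallI)
      fix c :: real
      assume c: "0 < c"
      have pj: "0 < p j" and qj: "0 < q j"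
        using p q j by auto
      have der: "(h has_derivative D j) (at (p j, q j))"
        unfolding h_def D_def
        by (rule derivative_eq_intros refl | simp add: pj qj)+
          (use pj qj in \<open>auto simp: fun_eq_iff powr_divide powr_diff abs_of_pos field_simps\<close>)
      have dist: "norm ((fst z j, snd z j) - (p j, q j)) \<le> d z" for z
      proof -
        have "norm ((fst z j, snd z j) - (p j, q j)) \<le> \<bar>fst z j - p j\<bar> + \<bar>snd z j - q j\<bar>"
          using norm_Pair_le[of "fst z j - p j" "snd z j - q j"] by simp
        also have "\<dots> \<le> d z"
          unfolding d_def by (intro add_mono abs_diff_le_l1_dist j)
        finally show ?thesis .
      qed
      have lim: "filterlim (\<lambda>z. (fst z j, snd z j)) (nhds (p j, q j)) F"
        by (rule Lim_transform[OF tendsto_const], rule Lim_null_comparison[OF _ d_lim])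
          (rule always_eventually, intro allI dist)
      show "\<forall>\<^sub>F z in F. norm (h (fst z j, snd z j) - h (p j, q j) - D j (fst z j - p j, snd z j - q j)) \<le> c * norm (d z)"
        using smallo_has_derivative[OF der lim dist] c d_nonneg by simp
    qed
    then have "(\<lambda>z. \<Sum>j=1..r. h (fst z j, snd z j) - h (p j, q j) - D j (fst z j - p j, snd z j - q j)) \<in> o[F](d)"
      by (rule big_sum_in_smallo)
    then show ?thesis
      by (simp add: \<Delta>_def LS_def Sp_def S_alpha_def h_def sum_subtractf)
  qed
  \<comment> \<open>That \<open>\<Delta>\<close> is O(d) serves twice: it yields
    \<open>\<Delta>\<close> tending to 0, needed to differentiate \<open>ln\<close>, and it turns
    the o(\<Delta>) error of \<open>ln\<close> into o(d).\<close>
  have "LS \<in> O[F](d)"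
    unfolding LS_def
  proof (rule big_sum_in_bigo)
    fix j assume j: "j \<in> {1..r}"
    have "(\<lambda>z. fst z j - p j) \<in> O[F](d)" "(\<lambda>z. snd z j - q j) \<in> O[F](d)"
      using add_mono[OF abs_diff_le_l1_dist[OF j] l1_dist_nonneg]
        add_mono[OF l1_dist_nonneg abs_diff_le_l1_dist[OF j]] d_nonneg
      by (auto intro!: bigoI[where c = 1] always_eventually simp: d_def)
    then show "(\<lambda>z. D j (fst z j - p j, snd z j - q j)) \<in> O[F](d)"
      by (auto simp: D_def intro!: sum_in_bigo)
  qed
  then have \<Delta>_O: "\<Delta> \<in> O[F](d)"
    using sum_in_bigo(1)[OF landau_o.small_imp_big[OF S_diff]] by fastforce
  have \<Delta>_lim: "(\<Delta> \<longlongrightarrow> 0) F"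
  proof -
    obtain C where "\<forall>\<^sub>F z in F. norm (\<Delta> z) \<le> C * norm (d z)"
      using \<Delta>_O by (rule landau_o.bigE)
    moreover have "((\<lambda>z. C * norm (d z)) \<longlongrightarrow> 0) F"
      using d_lim by (intro tendsto_mult_right_zero tendsto_norm_zero)
    ultimately show ?thesis
      by (rule Lim_null_comparison)
  qed
  have "(\<lambda>z. ln (Sp + \<Delta> z) - ln Sp - \<Delta> z / Sp) \<in> o[F](\<Delta>)"
  proof (rule landau_o.smallI)
    fix c :: real
    assume c: "0 < c"
    have der: "(ln has_derivative (\<lambda>h. h / Sp)) (at Sp)"
      by (rule has_derivative_eq_rhs[OF DERIV_ln[OF Sp, unfolded has_field_derivative_def]])
        (simp add: fun_eq_iff field_simps)
    have lim: "filterlim (\<lambda>z. Sp + \<Delta> z) (nhds Sp) F"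
      using tendsto_add[OF tendsto_const \<Delta>_lim] by simp
    show "\<forall>\<^sub>F z in F. norm (ln (Sp + \<Delta> z) - ln Sp - \<Delta> z / Sp) \<le> c * norm (\<Delta> z)"
      using smallo_has_derivative[OF der lim, of "\<lambda>z. norm (\<Delta> z)"] c by simp
  qed
  then have "(\<lambda>z. ln (Sp + \<Delta> z) - ln Sp - \<Delta> z / Sp) \<in> o[F](d)"
    using \<Delta>_O by (rule landau_o.small_big_trans)
  moreover have "(\<lambda>z. (\<Delta> z - LS z) / Sp) \<in> o[F](d)"
    using S_diff Sp by simp
  \<comment> \<open>The error of \<open>ln\<close> plus the error of \<open>S_alpha\<close> divided
    by \<open>Sp\<close>: the intermediate term \<open>\<Delta> z / Sp\<close> cancels.\<close>
  ultimately have "(\<lambda>z. (ln (Sp + \<Delta> z) - ln Sp - \<Delta> z / Sp) + (\<Delta> z - LS z) / Sp) \<in> o[F](d)"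
    by (rule sum_in_smallo)
  then have "(\<lambda>z. ln (Sp + \<Delta> z) - ln Sp - LS z / Sp) \<in> o[F](d)"
    by (simp add: diff_divide_distrib add_diff_eq)
  then have "(\<lambda>z. 1 / (\<alpha> - 1) * (ln (Sp + \<Delta> z) - ln Sp - LS z / Sp)) \<in> o[F](d)"
    by (subst landau_o.small.cmult_in_iff) (use \<alpha> in auto)
  then have "\<forall>\<^sub>F z in F. norm (1 / (\<alpha> - 1) * (ln (Sp + \<Delta> z) - ln Sp - LS z / Sp)) \<le> \<epsilon> * norm (d z)"
    using \<epsilon> by (rule landau_o.smallD)
  then obtain \<delta> where "0 < \<delta>" and \<delta>: "\<And>z. \<bar>d z\<bar> < \<delta> \<Longrightarrow>
      norm (1 / (\<alpha> - 1) * (ln (Sp + \<Delta> z) - ln Sp - LS z / Sp)) \<le> \<epsilon> * norm (d z)"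
    unfolding F_def eventually_filtercomap eventually_nhds_metric by (auto simp: dist_real_def)
  show ?thesis
  proof (intro exI[of _ \<delta>] conjI allI impI)
    fix x y
    assume "l1_dist r x p + l1_dist r y q < \<delta>"
    then have "norm (1 / (\<alpha> - 1) * (ln (Sp + \<Delta> (x, y)) - ln Sp - LS (x, y) / Sp)) \<le> \<epsilon> * norm (d (x, y))"
      using d_nonneg[of "(x, y)"] by (intro \<delta>) (simp add: d_def)
    moreover have "1 / (\<alpha> - 1) * (LS (x, y) / Sp) = (\<Sum>j=1..r. grad_p r \<alpha> p q j * (x j - p j))
        + (\<Sum>j=1..r. grad_q r \<alpha> p q j * (y j - q j))"
    proof -
      have "1 / (\<alpha> - 1) * (D j (x j - p j, y j - q j) / Sp)
          = grad_p r \<alpha> p q j * (x j - p j) + grad_q r \<alpha> p q j * (y j - q j)" for j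
      proof -
        \<comment> \<open>This quotient is the reason why \<open>grad_q\<close> has the bare factor
          -1.\<close>
        have "(1 - \<alpha>) / (\<alpha> - 1) = - 1"
          using \<alpha> by (simp add: field_simps)
        moreover have "1 / (\<alpha> - 1) * (D j (x j - p j, y j - q j) / Sp)
            = grad_p r \<alpha> p q j * (x j - p j)
              + (1 - \<alpha>) / (\<alpha> - 1) * ((p j / q j) powr \<alpha> / Sp * (y j - q j))"
          by (simp add: D_def grad_p_def Sp_def add_divide_distrib distrib_left)
        ultimately show ?thesis
          by (simp add: grad_q_def Sp_def)
      qed
      then show ?thesis
        unfolding LS_def sum_divide_distrib sum_distrib_left by (simp add: sum.distrib)
    qed
    ultimately show "\<bar>renyi_div r \<alpha> x y - renyi_div r \<alpha> p q
        - ((\<Sum>j=1..r. grad_p r \<alpha> p q j * (x j - p j)) + (\<Sum>j=1..r. grad_q r \<alpha> p q j * (y j - q j)))\<bar>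
      \<le> \<epsilon> * (l1_dist r x p + l1_dist r y q)"
      using d_nonneg[of "(x, y)"]
      by (simp add: renyi_div_def \<Delta>_def d_def right_diff_distrib flip: Sp_def)
  qed fact
qed

section \<open>Empirical masses\<close>

text \<open>Injectivity makes the singletons of the image disjoint blocks of indices; independence
  of blocks is then composed with evaluation at \<open>f i\<close>. It extracts each sample from the
  joint family.\<close>

lemma (in prob_space) indep_vars_reindex:
  assumes "indep_vars M' X (f ` I)" "inj_on f I"
  shows "indep_vars (\<lambda>i. M' (f i)) (\<lambda>i. X (f i)) I"
proof -
  have "indep_vars (\<lambda>i. PiM {f i} M') (\<lambda>i \<omega>. restrict (\<lambda>j. X j \<omega>) {f i}) I"
    using assms(2) by (intro indep_vars_restrict[OF assms(1)]) (auto simp: disjoint_family_on_def inj_on_def)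
  from indep_vars_compose2[OF this, of "\<lambda>i g. g (f i)" "\<lambda>i. M' (f i)"] show ?thesis
    by simp
qed

text \<open>
  The centred contribution of one observation to the linear statistic with weights \<open>a\<close>; on the
  support it equals \<open>a j\<close> minus its mean, so that its variance is \<^const>\<open>multinomial_var\<close>.
\<close>

definition score :: "nat \<Rightarrow> (nat \<Rightarrow> 'b) \<Rightarrow> (nat \<Rightarrow> real) \<Rightarrow> (nat \<Rightarrow> real) \<Rightarrow> 'b \<Rightarrow> real" where
  "score r c p a x = (\<Sum>j=1..r. a j * (of_bool (x = c j) - p j))"

lemma score_bounded:
  obtains B where "0 \<le> B" "\<And>x. \<bar>score r c p a x\<bar> \<le> B"
proof
  show "\<bar>score r c p a x\<bar> \<le> (\<Sum>j=1..r. \<bar>a j\<bar> * (1 + \<bar>p j\<bar>))" for x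
    unfolding score_def
    by (rule order_trans[OF sum_abs]) (auto simp: abs_mult intro!: sum_mono mult_left_mono)
qed (auto intro!: sum_nonneg)

lemma sum_score:
  assumes "1 \<le> n"
  shows "(\<Sum>i=1..n. score r c p a (Z i \<omega>)) = n * (\<Sum>j=1..r. a j * (emp_prob Z n (c j) \<omega> - p j))"
proof -
  have "(\<Sum>i=1..n. score r c p a (Z i \<omega>))
      = (\<Sum>j=1..r. a j * (\<Sum>i=1..n. of_bool (Z i \<omega> = c j) - p j))"
    unfolding score_def sum_distrib_left by (rule sum.swap)
  also have "\<dots> = (\<Sum>j=1..r. n * (a j * (emp_prob Z n (c j) \<omega> - p j)))"
    using assms by (intro sum.cong) (auto simp: emp_prob_def sum_subtractf field_simps)
  finally show ?thesis
    by (simp add: sum_distrib_left)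
qed

text \<open>For \<open>n = 0\<close> the empirical masses are 0 and the left sum need not vanish,
  whereas the right side is 0. The scales in use vanish there, which the hypothesis records.\<close>

lemma mult_sum_diff_eq_score:
  assumes "n = 0 \<Longrightarrow> N = 0"
  shows "N * (\<Sum>j=1..r. a j * (emp_prob Z n (c j) \<omega> - p j)) = N / n * (\<Sum>i=1..n. score r c p a (Z i \<omega>))"
  using assms sum_score[of n r c p a Z \<omega>] by (cases "n = 0") auto

lemma sqrt_mult_inverse_tendsto_0:
  assumes u: "u \<longlonglongrightarrow> U" and n: "filterlim n at_top sequentially"
  shows "(\<lambda>k. sqrt (real (n k)) * u k / real (n k)) \<longlonglongrightarrow> 0"
proof -
  have "filterlim (\<lambda>k. sqrt (real (n k))) at_top sequentially"
    by (intro filterlim_compose[OF sqrt_at_top] filterlim_compose[OF filterlim_real_sequentially] n)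
  then have "(\<lambda>k. u k / sqrt (real (n k))) \<longlonglongrightarrow> 0"
    by (intro tendsto_divide_0[OF u] filterlim_at_top_imp_at_infinity)
  moreover have "sqrt (real (n k)) * u k / real (n k) = u k / sqrt (real (n k))" for k
    using real_div_sqrt[of "real (n k)"] by (cases "n k = 0") (auto simp: field_simps)
  ultimately show ?thesis
    by simp
qed

text \<open>The total weight of \<open>n k\<close> summands of equal scale. It holds only
  eventually, since the left side is 0 when \<open>n k = 0\<close>.\<close>

lemma square_sqrt_mult_eventually:
  assumes n: "filterlim n at_top sequentially"
  shows "\<forall>\<^sub>F k in sequentially. (sqrt (real (n k)) * u k / real (n k))\<^sup>2 * real (n k) = (u k)\<^sup>2"
proof -
  have "\<forall>\<^sub>F k in sequentially. 1 \<le> n k"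
    using n by (simp add: filterlim_at_top)
  then show ?thesis
    by eventually_elim (simp add: power_mult_distrib power_divide, simp add: power2_eq_square)
qed

text \<open>Independence over the discrete space on the outcomes also supplies measurability and the
  fact that each \<open>Z i\<close> stays in the support on all of \<open>space M\<close>.\<close>

locale categorical_sample = prob_space M for M :: "'w measure" +
  fixes Z :: "nat \<Rightarrow> 'w \<Rightarrow> 'b" and r :: nat and c :: "nat \<Rightarrow> 'b" and p :: "nat \<Rightarrow> real"
  assumes inj: "inj_on c {1..r}"
    and total: "(\<Sum>j=1..r. p j) = 1"
    and indep: "indep_vars (\<lambda>_. count_space (c ` {1..r})) Z {1..}"
    and law: "\<And>i j. 1 \<le> i \<Longrightarrow> j \<in> {1..r} \<Longrightarrow> prob {\<omega> \<in> space M. Z i \<omega> = c j} = p j"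
begin

lemma rv: "1 \<le> i \<Longrightarrow> Z i \<in> M \<rightarrow>\<^sub>M count_space (c ` {1..r})"
  using indep by (auto simp: indep_vars_def)

lemma event: "1 \<le> i \<Longrightarrow> j \<in> {1..r} \<Longrightarrow> {\<omega> \<in> space M. Z i \<omega> = c j} \<in> events"
  using measurable_sets[OF rv, of i "{c j}"] by (simp add: vimage_def Int_def conj_commute)

lemma borel_measurable_of_rv: "1 \<le> i \<Longrightarrow> random_variable borel (\<lambda>\<omega>. f (Z i \<omega>) :: real)"
  by (rule measurable_compose[OF rv]) auto

lemma expectation_of_rv:
  assumes i: "1 \<le> i"
  shows "expectation (\<lambda>\<omega>. f (Z i \<omega>)) = (\<Sum>j=1..r. f (c j) * p j)"
proof -
  define E where "E j = {\<omega> \<in> space M. Z i \<omega> = c j}" for j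
  have E: "E j \<in> events" "prob (E j) = p j" if "j \<in> {1..r}" for j
    using event[OF i that] law[OF i that] by (auto simp: E_def)
  have "f (Z i \<omega>) = (\<Sum>j=1..r. f (c j) * indicat_real (E j) \<omega>)" if \<omega>: "\<omega> \<in> space M" for \<omega>
  proof -
    obtain j0 where j0: "j0 \<in> {1..r}" "Z i \<omega> = c j0"
      using measurable_space[OF rv[OF i] \<omega>] by auto
    have "indicat_real (E j) \<omega> = of_bool (j = j0)" if "j \<in> {1..r}" for j
      using inj_on_eq_iff[OF inj that j0(1)] j0(2) \<omega> by (auto simp: E_def)
    then have "(\<Sum>j=1..r. f (c j) * indicat_real (E j) \<omega>) = (\<Sum>j=1..r. if j = j0 then f (c j) else 0)"
      by (intro sum.cong) auto
    then show ?thesis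
      using j0 by simp
  qed
  then have "expectation (\<lambda>\<omega>. f (Z i \<omega>)) = expectation (\<lambda>\<omega>. \<Sum>j=1..r. f (c j) * indicat_real (E j) \<omega>)"
    by (intro Bochner_Integration.integral_cong refl)
  also have "\<dots> = (\<Sum>j=1..r. expectation (\<lambda>\<omega>. f (c j) * indicat_real (E j) \<omega>))"
    using E(1) by (intro Bochner_Integration.integral_sum integrable_mult_right integrable_real_indicator)
      (auto simp: less_top[symmetric])
  also have "\<dots> = (\<Sum>j=1..r. f (c j) * p j)"
    using E by (intro sum.cong) auto
  finally show ?thesis .
qed

lemma score_at:
  assumes "j \<in> {1..r}"
  shows "score r c p a (c j) = a j - (\<Sum>j=1..r. a j * p j)"
proof -
  have "(\<Sum>i=1..r. a i * of_bool (c j = c i)) = (\<Sum>i=1..r. if i = j then a i else 0)"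
    using inj_on_eq_iff[OF inj assms] by (intro sum.cong) auto
  then show ?thesis
    using assms by (simp add: score_def right_diff_distrib sum_subtractf)
qed

lemma expectation_score:
  assumes "1 \<le> i"
  shows "expectation (\<lambda>\<omega>. score r c p a (Z i \<omega>)) = 0"
proof -
  define \<mu> where "\<mu> = (\<Sum>j=1..r. a j * p j)"
  have "expectation (\<lambda>\<omega>. score r c p a (Z i \<omega>)) = (\<Sum>j=1..r. (a j - \<mu>) * p j)"
    using expectation_of_rv[OF assms, of "score r c p a"] by (simp add: score_at \<mu>_def)
  also have "\<dots> = \<mu> - \<mu> * (\<Sum>j=1..r. p j)"
    by (simp add: left_diff_distrib sum_subtractf sum_distrib_left \<mu>_def)
  finally show ?thesis
    using total by simp
qed

lemma expectation_score_square:
  assumes "1 \<le> i"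
  shows "expectation (\<lambda>\<omega>. (score r c p a (Z i \<omega>))\<^sup>2) = multinomial_var r p a"
proof -
  define \<mu> where "\<mu> = (\<Sum>j=1..r. a j * p j)"
  have "expectation (\<lambda>\<omega>. (score r c p a (Z i \<omega>))\<^sup>2) = (\<Sum>j=1..r. (a j - \<mu>)\<^sup>2 * p j)"
    using expectation_of_rv[OF assms, of "\<lambda>x. (score r c p a x)\<^sup>2"] by (simp add: score_at \<mu>_def)
  also have "\<dots> = (\<Sum>j=1..r. (a j)\<^sup>2 * p j) - 2 * \<mu> * (\<Sum>j=1..r. a j * p j) + \<mu>\<^sup>2 * (\<Sum>j=1..r. p j)"
    unfolding sum_distrib_left sum_subtractf[symmetric] sum.distrib[symmetric]
    by (intro sum.cong refl) (simp add: power2_diff algebra_simps)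
  also have "\<dots> = multinomial_var r p a"
    unfolding multinomial_var_def \<mu>_def[symmetric] total by (simp add: power2_eq_square)
  finally show ?thesis .
qed

text \<open>It is the second moment of a score; \<open>order_refl\<close> selects the observation
  with index 1.\<close>

lemma multinomial_var_nonneg: "0 \<le> multinomial_var r p a"
  unfolding expectation_score_square[OF order_refl, symmetric] by simp

lemma borel_measurable_emp_prob:
  assumes "j \<in> {1..r}"
  shows "random_variable borel (emp_prob Z n (c j))"
proof -
  have "random_variable borel (\<lambda>\<omega>. \<Sum>i=1..n. of_bool (Z i \<omega> = c j) :: real)"
    using borel_measurable_of_rv[of _ "\<lambda>x. of_bool (x = c j)"] by (intro borel_measurable_sum) auto
  then show ?thesis
    unfolding emp_prob_def[abs_def] by simp
qed

lemma emp_prob_bounds: "0 \<le> emp_prob Z n x \<omega>" "emp_prob Z n x \<omega> \<le> 1"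
proof -
  show "0 \<le> emp_prob Z n x \<omega>"
    unfolding emp_prob_def by (intro mult_nonneg_nonneg sum_nonneg) auto
  have "(\<Sum>i=1..n. of_bool (Z i \<omega> = x)) \<le> (\<Sum>i=1..n. 1 :: real)"
    by (intro sum_mono) auto
  then have "1 / real n * (\<Sum>i=1..n. of_bool (Z i \<omega> = x)) \<le> 1 / real n * real n"
    by (intro mult_left_mono) auto
  then show "emp_prob Z n x \<omega> \<le> 1"
    unfolding emp_prob_def by (cases "n = 0") auto
qed

lemma integrable_emp_prob_diff:
  assumes "j \<in> {1..r}"
  shows "integrable M (\<lambda>\<omega>. \<bar>emp_prob Z n (c j) \<omega> - p j\<bar>)"
proof (rule integrable_const_bound[where B = "1 + \<bar>p j\<bar>"])
  have "norm \<bar>emp_prob Z n (c j) \<omega> - p j\<bar> \<le> 1 + \<bar>p j\<bar>" for \<omega>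
    using emp_prob_bounds[of n "c j" \<omega>] by auto
  then show "AE \<omega> in M. norm \<bar>emp_prob Z n (c j) \<omega> - p j\<bar> \<le> 1 + \<bar>p j\<bar>"
    by (intro AE_I2)
qed (use borel_measurable_emp_prob[OF assms] in auto)

lemma indep_score: "indep_vars (\<lambda>_. borel) (\<lambda>i \<omega>. score r c p a (Z i \<omega>)) {1..n}"
  by (rule indep_vars_compose2[OF indep_vars_subset[OF indep]]) auto

text \<open>The elementary bound u <= 1 + u^2 replaces the Cauchy-Schwarz inequality: the second
  moment of the scaled deviation is a variance by independence, and any bound free of
  \<open>n\<close> suffices.\<close>

lemma sqrt_mult_expectation_emp_prob_diff_le:
  assumes j: "j \<in> {1..r}"
  shows "sqrt n * expectation (\<lambda>\<omega>. \<bar>emp_prob Z n (c j) \<omega> - p j\<bar>)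
    \<le> 1 + multinomial_var r p (\<lambda>i. of_bool (i = j))"
proof (cases "n = 0")
  case True
  then show ?thesis
    by (simp add: multinomial_var_nonneg add_nonneg_nonneg)
next
  case False
  \<comment> \<open>Indicator weights reduce the linear statistic to the single deviation at
    \<open>j\<close>.\<close>
  define a :: "nat \<Rightarrow> real" where "a i = of_bool (i = j)" for i
  let ?S = "\<lambda>\<omega>. \<Sum>i=1..n. score r c p a (Z i \<omega>)"
  have pos: "0 < sqrt n"
    using False by simp
  have S: "?S \<omega> = n * (emp_prob Z n (c j) \<omega> - p j)" for \<omega>
  proof -
    have "(\<Sum>i=1..r. a i * (emp_prob Z n (c i) \<omega> - p i))
        = (\<Sum>i=1..r. if i = j then emp_prob Z n (c i) \<omega> - p i else 0)"
      by (intro sum.cong) (auto simp: a_def)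
    also have "\<dots> = emp_prob Z n (c j) \<omega> - p j"
      using j by simp
    finally show ?thesis
      using sum_score[of n r c p a Z \<omega>] False by simp
  qed
  have int: "integrable M (\<lambda>\<omega>. (?S \<omega>)\<^sup>2)" and ES: "expectation (\<lambda>\<omega>. (?S \<omega>)\<^sup>2) = n * multinomial_var r p a"
  proof -
    obtain B where B: "0 \<le> B" "\<And>x. \<bar>score r c p a x\<bar> \<le> B"
      using score_bounded[of r c p a] by blast
    have sq: "integrable M (\<lambda>\<omega>. (score r c p a (Z i \<omega>))\<^sup>2)" if "i \<in> {1..n}" for i
      using borel_measurable_of_rv[of i "score r c p a"] that B
      by (intro integrable_const_bound[where B = "B\<^sup>2"]) (auto simp flip: abs_le_square_iff)
    note M = second_moment_sum_indep[OF _ indep_score sq expectation_score]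
    show "integrable M (\<lambda>\<omega>. (?S \<omega>)\<^sup>2)"
      by (rule M(1)) auto
    show "expectation (\<lambda>\<omega>. (?S \<omega>)\<^sup>2) = n * multinomial_var r p a"
      by (subst M(2)) (auto simp: expectation_score_square)
  qed
  have le: "sqrt n * \<bar>emp_prob Z n (c j) \<omega> - p j\<bar> \<le> 1 + (?S \<omega>)\<^sup>2 / n" for \<omega>
  proof -
    define u where "u = sqrt n * \<bar>emp_prob Z n (c j) \<omega> - p j\<bar>"
    have "2 * u \<le> u\<^sup>2 + 1"
      using sum_squares_bound[of u 1] by simp
    moreover have "0 \<le> u\<^sup>2"
      by simp
    ultimately have "u \<le> 1 + u\<^sup>2"
      by linarith
    moreover have "u\<^sup>2 = (?S \<omega>)\<^sup>2 / n"
      using False unfolding S u_def by (simp add: power_mult_distrib power2_eq_square[of "real n"])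
    ultimately show ?thesis
      by (simp add: u_def)
  qed
  have "expectation (\<lambda>\<omega>. sqrt n * \<bar>emp_prob Z n (c j) \<omega> - p j\<bar>) \<le> expectation (\<lambda>\<omega>. 1 + (?S \<omega>)\<^sup>2 / n)"
    using integrable_emp_prob_diff[OF j] int by (intro integral_mono le) auto
  also have "\<dots> = 1 + multinomial_var r p a"
    using int False ES by (simp add: prob_space)
  finally show ?thesis
    by (simp add: a_def[abs_def])
qed

lemma l1_dist_emp_prob:
  shows "integrable M (\<lambda>\<omega>. l1_dist r (\<lambda>j. emp_prob Z n (c j) \<omega>) p)"
    and "sqrt n * expectation (\<lambda>\<omega>. l1_dist r (\<lambda>j. emp_prob Z n (c j) \<omega>) p)
      \<le> (\<Sum>j=1..r. 1 + multinomial_var r p (\<lambda>i. of_bool (i = j)))"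
proof -
  show "integrable M (\<lambda>\<omega>. l1_dist r (\<lambda>j. emp_prob Z n (c j) \<omega>) p)"
    unfolding l1_dist_def using integrable_emp_prob_diff by (intro Bochner_Integration.integrable_sum) auto
  have "sqrt n * expectation (\<lambda>\<omega>. l1_dist r (\<lambda>j. emp_prob Z n (c j) \<omega>) p)
      = (\<Sum>j=1..r. sqrt n * expectation (\<lambda>\<omega>. \<bar>emp_prob Z n (c j) \<omega> - p j\<bar>))"
    unfolding l1_dist_def using integrable_emp_prob_diff
    by (subst Bochner_Integration.integral_sum) (auto simp: sum_distrib_left)
  also have "\<dots> \<le> (\<Sum>j=1..r. 1 + multinomial_var r p (\<lambda>i. of_bool (i = j)))"
    by (intro sum_mono sqrt_mult_expectation_emp_prob_diff_le)
  finally show "sqrt n * expectation (\<lambda>\<omega>. l1_dist r (\<lambda>j. emp_prob Z n (c j) \<omega>) p)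
      \<le> (\<Sum>j=1..r. 1 + multinomial_var r p (\<lambda>i. of_bool (i = j)))" .
qed

end

section \<open>The delta method for the divergence\<close>

text \<open>Both arguments are random so that all three limits are instances. In the one-sample
  cases one vector is constant, with distance 0 and tightness constant 0.\<close>

lemma (in prob_space) renyi_div_delta_method:
  assumes p: "\<And>j. j \<in> {1..r} \<Longrightarrow> p j > 0" and q: "\<And>j. j \<in> {1..r} \<Longrightarrow> q j > 0"
    and r: "1 \<le> r" and \<alpha>: "\<alpha> \<noteq> 1"
    and N: "filterlim N at_top sequentially"
    and x_rv: "\<And>k j. j \<in> {1..r} \<Longrightarrow> random_variable borel (\<lambda>\<omega>. x k \<omega> j)"
    and y_rv: "\<And>k j. j \<in> {1..r} \<Longrightarrow> random_variable borel (\<lambda>\<omega>. y k \<omega> j)"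
    and x_int: "\<And>k. integrable M (\<lambda>\<omega>. l1_dist r (x k \<omega>) p)"
    and y_int: "\<And>k. integrable M (\<lambda>\<omega>. l1_dist r (y k \<omega>) q)"
    and x_tight: "\<And>k. N k * expectation (\<lambda>\<omega>. l1_dist r (x k \<omega>) p) \<le> C1"
    and y_tight: "\<And>k. N k * expectation (\<lambda>\<omega>. l1_dist r (y k \<omega>) q) \<le> C2"
    and L: "real_distribution L"
    and lin: "conv_in_distr M (\<lambda>k \<omega>. N k * ((\<Sum>j=1..r. grad_p r \<alpha> p q j * (x k \<omega> j - p j))
      + (\<Sum>j=1..r. grad_q r \<alpha> p q j * (y k \<omega> j - q j)))) L"
  shows "conv_in_distr M (\<lambda>k \<omega>. N k * (renyi_div r \<alpha> (x k \<omega>) (y k \<omega>) - renyi_div r \<alpha> p q)) L"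
proof (rule slutsky[OF lin L])
  let ?lin = "\<lambda>k \<omega>. (\<Sum>j=1..r. grad_p r \<alpha> p q j * (x k \<omega> j - p j))
      + (\<Sum>j=1..r. grad_q r \<alpha> p q j * (y k \<omega> j - q j))"
  let ?diff = "\<lambda>k \<omega>. renyi_div r \<alpha> (x k \<omega>) (y k \<omega>) - renyi_div r \<alpha> p q"
  have lin_rv [measurable]: "random_variable borel (?lin k)" for k
    using x_rv y_rv
    by (intro borel_measurable_add borel_measurable_sum borel_measurable_times borel_measurable_diff) auto
  have diff_rv [measurable]: "random_variable borel (?diff k)" for k
    unfolding renyi_div_def S_alpha_def using x_rv y_rv by measurable
  show "random_variable borel (\<lambda>\<omega>. N k * ?lin k \<omega>)" "random_variable borel (\<lambda>\<omega>. N k * ?diff k \<omega>)" for k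
    by measurable
  fix \<epsilon> :: real
  assume \<epsilon>: "0 < \<epsilon>"
  have "(\<lambda>k. prob {\<omega> \<in> space M. \<epsilon> < \<bar>N k * (?diff k \<omega> - ?lin k \<omega>)\<bar>}) \<longlonglongrightarrow> 0"
  proof (rule delta_remainder_tendsto_0[OF N, where D = "\<lambda>k \<omega>. l1_dist r (x k \<omega>) p + l1_dist r (y k \<omega>) q"])
    show "N k * expectation (\<lambda>\<omega>. l1_dist r (x k \<omega>) p + l1_dist r (y k \<omega>) q) \<le> C1 + C2" for k
      using add_mono[OF x_tight[of k] y_tight[of k]] x_int[of k] y_int[of k] by (simp add: distrib_left)
    show "\<exists>\<delta>>0. \<forall>k. \<forall>\<omega>\<in>space M. l1_dist r (x k \<omega>) p + l1_dist r (y k \<omega>) q < \<delta> \<longrightarrow>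
        \<bar>?diff k \<omega> - ?lin k \<omega>\<bar> \<le> \<epsilon> * (l1_dist r (x k \<omega>) p + l1_dist r (y k \<omega>) q)" if "0 < \<epsilon>" for \<epsilon>
      using renyi_div_differentiable[of r p q \<alpha> \<epsilon>, OF p q r \<alpha> that] by blast
    show "random_variable borel (\<lambda>\<omega>. ?diff k \<omega> - ?lin k \<omega>)" for k
      by measurable
  qed (use x_int y_int \<epsilon> in \<open>auto simp: l1_dist_nonneg\<close>)
  then show "(\<lambda>k. prob {\<omega> \<in> space M. \<epsilon> < \<bar>N k * ?diff k \<omega> - N k * ?lin k \<omega>\<bar>}) \<longlonglongrightarrow> 0"
    by (simp add: right_diff_distrib)
qed

section \<open>Limit theorems for two independent samples\<close>

text \<open>Indexing by a disjoint sum expresses independence within and between the samples as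
  independence of one family.\<close>

locale two_categorical_samples =
  X: categorical_sample M X r c p + Y: categorical_sample M Y r c q
  for M :: "'w measure" and X Y :: "nat \<Rightarrow> 'w \<Rightarrow> 'b" and r c p q +
  assumes indep: "X.indep_vars (\<lambda>_. count_space (c ` {1..r})) (case_sum X Y) ({1..} <+> {1..})"
begin

lemma weighted_score_clt:
  fixes s t :: "nat \<Rightarrow> real" and n m :: "nat \<Rightarrow> nat"
  assumes s: "s \<longlonglongrightarrow> 0" and t: "t \<longlonglongrightarrow> 0"
    and v: "(\<lambda>k. (s k)\<^sup>2 * n k * multinomial_var r p a + (t k)\<^sup>2 * m k * multinomial_var r q b) \<longlonglongrightarrow> v"
  shows "conv_in_distr M (\<lambda>k \<omega>. s k * (\<Sum>i=1..n k. score r c p a (X i \<omega>))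
    + t k * (\<Sum>i=1..m k. score r c q b (Y i \<omega>))) (normal_law 0 v)"
proof -
  \<comment> \<open>Each summand is written as a function of its index and one member of the joint
    family, the form in which independence passes to the scores.\<close>
  define g where "g k z x = (case z of Inl _ \<Rightarrow> s k * score r c p a x | Inr _ \<Rightarrow> t k * score r c q b x)"
    for k x and z :: "nat + nat"
  define W where "W k z \<omega> = g k z (case_sum X Y z \<omega>)" for k z \<omega>
  obtain A where A: "0 \<le> A" "\<And>x. \<bar>score r c p a x\<bar> \<le> A"
    using score_bounded[of r c p a] by blast
  obtain B where B: "0 \<le> B" "\<And>x. \<bar>score r c q b x\<bar> \<le> B"
    using score_bounded[of r c q b] by blast
  have W: "W k (Inl i) = (\<lambda>\<omega>. s k * score r c p a (X i \<omega>))"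
      "W k (Inr i) = (\<lambda>\<omega>. t k * score r c q b (Y i \<omega>))" for k i
    by (simp_all add: W_def g_def fun_eq_iff)
  have sum_W: "(\<Sum>z\<in>{1..n k} <+> {1..m k}. W k z \<omega>)
      = s k * (\<Sum>i=1..n k. score r c p a (X i \<omega>)) + t k * (\<Sum>i=1..m k. score r c q b (Y i \<omega>))" for k \<omega>
    by (simp add: sum.Plus W sum_distrib_left)
  have "conv_in_distr M (\<lambda>k \<omega>. \<Sum>z\<in>{1..n k} <+> {1..m k}. W k z \<omega>) (normal_law 0 v)"
  proof (rule X.conv_in_distr_bounded_triangular_array)
    show "X.indep_vars (\<lambda>_. borel) (W k) ({1..n k} <+> {1..m k})" for k
      unfolding W_def by (rule X.indep_vars_compose2[OF X.indep_vars_subset[OF indep]]) auto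
    show "\<bar>W k z \<omega>\<bar> \<le> \<bar>s k\<bar> * A + \<bar>t k\<bar> * B" for k z \<omega>
    proof (cases z)
      case (Inl i)
      then show ?thesis
        using A B by (auto simp: W abs_mult intro!: add_increasing2 mult_left_mono)
    next
      case (Inr i)
      then show ?thesis
        using A B by (auto simp: W abs_mult intro!: add_increasing mult_left_mono)
    qed
    show "X.expectation (W k z) = 0" if "z \<in> {1..n k} <+> {1..m k}" for k z
      using that X.expectation_score Y.expectation_score by (auto simp: W)
    have "(\<Sum>z\<in>{1..n k} <+> {1..m k}. X.expectation (\<lambda>\<omega>. (W k z \<omega>)\<^sup>2))
        = (s k)\<^sup>2 * n k * multinomial_var r p a + (t k)\<^sup>2 * m k * multinomial_var r q b" for k
      by (simp add: sum.Plus W power_mult_distrib X.expectation_score_square Y.expectation_score_square)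
    then show "(\<lambda>k. \<Sum>z\<in>{1..n k} <+> {1..m k}. X.expectation (\<lambda>\<omega>. (W k z \<omega>)\<^sup>2)) \<longlonglongrightarrow> v"
      using v by simp
    show "(\<lambda>k. \<bar>s k\<bar> * A + \<bar>t k\<bar> * B) \<longlonglongrightarrow> 0"
      using s t by (auto intro!: tendsto_eq_intros)
  qed
  then show ?thesis
    unfolding sum_W .
qed

lemma V_R_nonneg:
  assumes "\<And>j. j \<in> {1..r} \<Longrightarrow> p j > 0" "\<And>j. j \<in> {1..r} \<Longrightarrow> q j > 0"
  shows "0 \<le> V_R1 r \<alpha> p q" "0 \<le> V_R2 r \<alpha> p q"
  using V_R1_eq[of r p q \<alpha>] V_R2_eq[of r p q \<alpha>] assms
    X.multinomial_var_nonneg[of "grad_p r \<alpha> p q"] Y.multinomial_var_nonneg[of "grad_q r \<alpha> p q"]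
  by auto

lemma renyi_div_clt_first:
  assumes p: "\<And>j. j \<in> {1..r} \<Longrightarrow> p j > 0" and q: "\<And>j. j \<in> {1..r} \<Longrightarrow> q j > 0"
    and r: "1 \<le> r" and \<alpha>: "\<alpha> \<noteq> 1"
  shows "conv_in_distr M
    (\<lambda>n \<omega>. sqrt (real n) * (renyi_div r \<alpha> (\<lambda>j. emp_prob X n (c j) \<omega>) q - renyi_div r \<alpha> p q))
    (normal_law 0 (V_R1 r \<alpha> p q))"
proof (rule X.renyi_div_delta_method[OF p q r \<alpha>, where x = "\<lambda>n \<omega> j. emp_prob X n (c j) \<omega>" and y = "\<lambda>_ _. q"])
  show "filterlim (\<lambda>n. sqrt (real n)) at_top sequentially"
    by (rule filterlim_compose[OF sqrt_at_top filterlim_real_sequentially])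
  show "real_distribution (normal_law 0 (V_R1 r \<alpha> p q))"
    by (intro real_distribution_normal_law V_R_nonneg p q)
  have s: "(\<lambda>n. sqrt (real n) * 1 / real n) \<longlonglongrightarrow> 0"
    by (rule sqrt_mult_inverse_tendsto_0[OF tendsto_const filterlim_ident])
  \<comment> \<open>The second sample enters with weight 0 and no observations; the factor 1 is the
    constant sequence \<open>u\<close> in the scaling lemmas.\<close>
  have "\<forall>\<^sub>F n in sequentially. (sqrt (real n) * 1 / real n)\<^sup>2 * real n * multinomial_var r p (grad_p r \<alpha> p q)
      + 0\<^sup>2 * real 0 * multinomial_var r q (grad_q r \<alpha> p q) = V_R1 r \<alpha> p q"
    using square_sqrt_mult_eventually[OF filterlim_ident, of "\<lambda>_. 1"]
    by eventually_elim (use V_R1_eq[of r p q \<alpha>] p q in auto)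
  then have "conv_in_distr M (\<lambda>n \<omega>. sqrt n * 1 / n * (\<Sum>i=1..n. score r c p (grad_p r \<alpha> p q) (X i \<omega>))
      + 0 * (\<Sum>i=1..0. score r c q (grad_q r \<alpha> p q) (Y i \<omega>))) (normal_law 0 (V_R1 r \<alpha> p q))"
    by (intro weighted_score_clt[OF s tendsto_const] tendsto_eventually)
  moreover have "sqrt n * ((\<Sum>j=1..r. grad_p r \<alpha> p q j * (emp_prob X n (c j) \<omega> - p j))
      + (\<Sum>j=1..r. grad_q r \<alpha> p q j * (q j - q j)))
    = sqrt n * 1 / n * (\<Sum>i=1..n. score r c p (grad_p r \<alpha> p q) (X i \<omega>))
      + 0 * (\<Sum>i=1..0. score r c q (grad_q r \<alpha> p q) (Y i \<omega>))" for n \<omega>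
    using mult_sum_diff_eq_score[of n "sqrt n" "grad_p r \<alpha> p q" X c \<omega> p r] by simp
  ultimately show "conv_in_distr M (\<lambda>n \<omega>. sqrt n * ((\<Sum>j=1..r. grad_p r \<alpha> p q j * (emp_prob X n (c j) \<omega> - p j))
      + (\<Sum>j=1..r. grad_q r \<alpha> p q j * (q j - q j)))) (normal_law 0 (V_R1 r \<alpha> p q))"
    by simp
  show "sqrt (real n) * X.expectation (\<lambda>\<omega>. l1_dist r q q) \<le> 0" for n
    by (simp add: l1_dist_def)
  show "sqrt (real n) * X.expectation (\<lambda>\<omega>. l1_dist r (\<lambda>j. emp_prob X n (c j) \<omega>) p)
      \<le> (\<Sum>j=1..r. 1 + multinomial_var r p (\<lambda>i. of_bool (i = j)))" for n
    by (rule X.l1_dist_emp_prob)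
qed (use X.borel_measurable_emp_prob X.l1_dist_emp_prob(1) in auto)

lemma renyi_div_clt_second:
  assumes p: "\<And>j. j \<in> {1..r} \<Longrightarrow> p j > 0" and q: "\<And>j. j \<in> {1..r} \<Longrightarrow> q j > 0"
    and r: "1 \<le> r" and \<alpha>: "\<alpha> \<noteq> 1"
  shows "conv_in_distr M
    (\<lambda>n \<omega>. sqrt (real n) * (renyi_div r \<alpha> p (\<lambda>j. emp_prob Y n (c j) \<omega>) - renyi_div r \<alpha> p q))
    (normal_law 0 (V_R2 r \<alpha> p q))"
proof (rule X.renyi_div_delta_method[OF p q r \<alpha>, where x = "\<lambda>_ _. p" and y = "\<lambda>n \<omega> j. emp_prob Y n (c j) \<omega>"])
  show "filterlim (\<lambda>n. sqrt (real n)) at_top sequentially"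
    by (rule filterlim_compose[OF sqrt_at_top filterlim_real_sequentially])
  show "real_distribution (normal_law 0 (V_R2 r \<alpha> p q))"
    by (intro real_distribution_normal_law V_R_nonneg p q)
  have t: "(\<lambda>n. sqrt (real n) * 1 / real n) \<longlonglongrightarrow> 0"
    by (rule sqrt_mult_inverse_tendsto_0[OF tendsto_const filterlim_ident])
  have "\<forall>\<^sub>F n in sequentially. 0\<^sup>2 * real 0 * multinomial_var r p (grad_p r \<alpha> p q)
      + (sqrt (real n) * 1 / real n)\<^sup>2 * real n * multinomial_var r q (grad_q r \<alpha> p q) = V_R2 r \<alpha> p q"
    using square_sqrt_mult_eventually[OF filterlim_ident, of "\<lambda>_. 1"]
    by eventually_elim (use V_R2_eq[of r p q \<alpha>] p q in auto)
  then have "conv_in_distr M (\<lambda>n \<omega>. 0 * (\<Sum>i=1..0. score r c p (grad_p r \<alpha> p q) (X i \<omega>))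
      + sqrt n * 1 / n * (\<Sum>i=1..n. score r c q (grad_q r \<alpha> p q) (Y i \<omega>))) (normal_law 0 (V_R2 r \<alpha> p q))"
    by (intro weighted_score_clt[OF tendsto_const t] tendsto_eventually)
  moreover have "sqrt n * ((\<Sum>j=1..r. grad_p r \<alpha> p q j * (p j - p j))
      + (\<Sum>j=1..r. grad_q r \<alpha> p q j * (emp_prob Y n (c j) \<omega> - q j)))
    = 0 * (\<Sum>i=1..0. score r c p (grad_p r \<alpha> p q) (X i \<omega>))
      + sqrt n * 1 / n * (\<Sum>i=1..n. score r c q (grad_q r \<alpha> p q) (Y i \<omega>))" for n \<omega>
    using mult_sum_diff_eq_score[of n "sqrt n" "grad_q r \<alpha> p q" Y c \<omega> q r] by simp
  ultimately show "conv_in_distr M (\<lambda>n \<omega>. sqrt n * ((\<Sum>j=1..r. grad_p r \<alpha> p q j * (p j - p j))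
      + (\<Sum>j=1..r. grad_q r \<alpha> p q j * (emp_prob Y n (c j) \<omega> - q j)))) (normal_law 0 (V_R2 r \<alpha> p q))"
    by simp
  show "sqrt (real n) * X.expectation (\<lambda>\<omega>. l1_dist r p p) \<le> 0" for n
    by (simp add: l1_dist_def)
  show "sqrt (real n) * X.expectation (\<lambda>\<omega>. l1_dist r (\<lambda>j. emp_prob Y n (c j) \<omega>) q)
      \<le> (\<Sum>j=1..r. 1 + multinomial_var r q (\<lambda>i. of_bool (i = j)))" for n
    by (rule Y.l1_dist_emp_prob)
qed (use Y.borel_measurable_emp_prob Y.l1_dist_emp_prob(1) in auto)

text \<open>The scale \<open>N\<close> equals sqrt n times \<open>u\<close> and also sqrt m times
  \<open>w\<close>, with convergent \<open>u\<close> and \<open>w\<close>. Each sample therefore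
  sees its own square-root scale, and the variance sums tend to (\<gamma> V1 + (1 - \<gamma>) V2) /
  d = 1.\<close>

lemma renyi_div_clt_two_samples:
  fixes n m :: "nat \<Rightarrow> nat"
  assumes p: "\<And>j. j \<in> {1..r} \<Longrightarrow> p j > 0" and q: "\<And>j. j \<in> {1..r} \<Longrightarrow> q j > 0"
    and r: "1 \<le> r" and \<alpha>: "\<alpha> \<noteq> 1"
    and n: "filterlim n at_top sequentially" and m: "filterlim m at_top sequentially"
    and \<gamma>: "0 < \<gamma>" "\<gamma> < 1"
    and ratio: "(\<lambda>k. real (m k) / (real (n k) + real (m k))) \<longlonglongrightarrow> \<gamma>"
    and V: "V_R1 r \<alpha> p q \<noteq> 0 \<or> V_R2 r \<alpha> p q \<noteq> 0"
  shows "conv_in_distr M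
    (\<lambda>k \<omega>. sqrt (real (m k) * real (n k) /
        (real (n k) * V_R2 r \<alpha> p q + real (m k) * V_R1 r \<alpha> p q)) *
      (renyi_div r \<alpha> (\<lambda>j. emp_prob X (n k) (c j) \<omega>) (\<lambda>j. emp_prob Y (m k) (c j) \<omega>)
        - renyi_div r \<alpha> p q))
    (normal_law 0 1)"
proof -
  define V1 where "V1 = V_R1 r \<alpha> p q"
  define V2 where "V2 = V_R2 r \<alpha> p q"
  define g where "g k = real (m k) / (real (n k) + real (m k))" for k
  define h where "h k = real (n k) / (real (n k) + real (m k))" for k
  \<comment> \<open>The denominator under the root of \<open>N\<close>, divided by n + m;
    \<open>d\<close> is its limit, positive because the variances do not both vanish.\<close>
  define D where "D k = h k * V2 + g k * V1" for k
  define d where "d = (1 - \<gamma>) * V2 + \<gamma> * V1"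
  define u where "u k = sqrt (g k / D k)" for k
  define w where "w k = sqrt (h k / D k)" for k
  define N where "N k = sqrt (real (m k) * real (n k) / (real (n k) * V2 + real (m k) * V1))" for k
  have V_nonneg: "0 \<le> V1" "0 \<le> V2"
    unfolding V1_def V2_def by (intro V_R_nonneg p q; assumption)+
  have d: "0 < d"
  proof (cases "V1 = 0")
    case True
    then have "0 < V2"
      using V V_nonneg by (auto simp: V1_def V2_def)
    then show ?thesis
      using True \<gamma> by (simp add: d_def)
  next
    case False
    then show ?thesis
      using V_nonneg \<gamma> by (auto simp: d_def intro!: add_nonneg_pos)
  qed
  have g: "g \<longlonglongrightarrow> \<gamma>"
    using ratio by (simp add: g_def[abs_def])
  \<comment> \<open>Excludes n + m = 0, where \<open>g k\<close> and \<open>h k\<close> are both 0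
    and do not sum to 1.\<close>
  have m_pos: "\<forall>\<^sub>F k in sequentially. 1 \<le> m k"
    using m by (simp add: filterlim_at_top)
  have h: "h \<longlonglongrightarrow> 1 - \<gamma>"
  proof (rule Lim_transform_eventually)
    show "(\<lambda>k. 1 - g k) \<longlonglongrightarrow> 1 - \<gamma>"
      by (intro tendsto_intros g)
    show "\<forall>\<^sub>F k in sequentially. 1 - g k = h k"
      using m_pos by eventually_elim (simp add: g_def h_def field_simps)
  qed
  have D: "D \<longlonglongrightarrow> d"
    unfolding D_def d_def by (intro tendsto_intros g h)
  have u: "u \<longlonglongrightarrow> sqrt (\<gamma> / d)" and w: "w \<longlonglongrightarrow> sqrt ((1 - \<gamma>) / d)"
    unfolding u_def w_def using d by (intro tendsto_intros g h D; simp)+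
  have N_u: "N k = sqrt (n k) * u k" and N_w: "N k = sqrt (m k) * w k" for k
  proof -
    have *: "D k = (real (n k) * V2 + real (m k) * V1) / (real (n k) + real (m k))"
      by (simp add: D_def g_def h_def add_divide_distrib)
    have "real (m k) * real (n k) / (real (n k) * V2 + real (m k) * V1) = n k * (g k / D k)"
      "real (m k) * real (n k) / (real (n k) * V2 + real (m k) * V1) = m k * (h k / D k)"
      unfolding * g_def h_def by auto
    then show "N k = sqrt (n k) * u k" "N k = sqrt (m k) * w k"
      unfolding N_def u_def w_def real_sqrt_mult[symmetric] by simp_all
  qed
  have uw_nonneg: "0 \<le> u k" "0 \<le> w k" for k
    unfolding u_def w_def g_def h_def D_def using V_nonneg by auto
  \<comment> \<open>The tightness hypothesis of the delta method concerns every \<open>k\<close>, so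
    a bound on the whole sequence is taken.\<close>
  obtain U where U: "\<And>k. u k \<le> U"
    using convergent_imp_bounded[OF u] unfolding bounded_iff by (metis abs_le_D1 rangeI real_norm_def)
  obtain W where W: "\<And>k. w k \<le> W"
    using convergent_imp_bounded[OF w] unfolding bounded_iff by (metis abs_le_D1 rangeI real_norm_def)
  have s: "(\<lambda>k. N k / n k) \<longlonglongrightarrow> 0" and t: "(\<lambda>k. N k / m k) \<longlonglongrightarrow> 0"
    using sqrt_mult_inverse_tendsto_0[OF u n] sqrt_mult_inverse_tendsto_0[OF w m]
    by (simp_all flip: N_u N_w)
  have var: "(\<lambda>k. (N k / n k)\<^sup>2 * n k * V1 + (N k / m k)\<^sup>2 * m k * V2) \<longlonglongrightarrow> 1"
  proof (rule Lim_transform_eventually)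
    have "(\<gamma> / d) * V1 + ((1 - \<gamma>) / d) * V2 = 1"
    proof -
      have "(\<gamma> / d) * V1 + ((1 - \<gamma>) / d) * V2 = d / d"
        unfolding d_def add_divide_distrib by (simp add: add.commute)
      then show ?thesis
        using d by simp
    qed
    moreover have "(\<lambda>k. (u k)\<^sup>2 * V1 + (w k)\<^sup>2 * V2)
        \<longlonglongrightarrow> (sqrt (\<gamma> / d))\<^sup>2 * V1 + (sqrt ((1 - \<gamma>) / d))\<^sup>2 * V2"
      by (intro tendsto_intros u w)
    ultimately show "(\<lambda>k. (u k)\<^sup>2 * V1 + (w k)\<^sup>2 * V2) \<longlonglongrightarrow> 1"
      using d \<gamma> by simp
    show "\<forall>\<^sub>F k in sequentially. (u k)\<^sup>2 * V1 + (w k)\<^sup>2 * V2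
        = (N k / n k)\<^sup>2 * n k * V1 + (N k / m k)\<^sup>2 * m k * V2"
      using square_sqrt_mult_eventually[OF n, of u] square_sqrt_mult_eventually[OF m, of w]
      by eventually_elim (simp flip: N_u N_w)
  qed
  have "conv_in_distr M (\<lambda>k \<omega>. N k *
      (renyi_div r \<alpha> (\<lambda>j. emp_prob X (n k) (c j) \<omega>) (\<lambda>j. emp_prob Y (m k) (c j) \<omega>) - renyi_div r \<alpha> p q))
    (normal_law 0 1)"
  proof (rule X.renyi_div_delta_method[OF p q r \<alpha>,
        where x = "\<lambda>k \<omega> j. emp_prob X (n k) (c j) \<omega>" and y = "\<lambda>k \<omega> j. emp_prob Y (m k) (c j) \<omega>"])
    have "filterlim (\<lambda>k. u k * sqrt (real (n k))) at_top sequentially"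
      using d \<gamma>
      by (intro filterlim_tendsto_pos_mult_at_top[OF u] filterlim_compose[OF sqrt_at_top]
          filterlim_compose[OF filterlim_real_sequentially] n) simp
    then show "filterlim N at_top sequentially"
      by (simp add: N_u[abs_def] mult.commute)
    show "real_distribution (normal_law 0 1)"
      by (simp add: real_distribution_normal_law)
    have "conv_in_distr M (\<lambda>k \<omega>. N k / n k * (\<Sum>i=1..n k. score r c p (grad_p r \<alpha> p q) (X i \<omega>))
        + N k / m k * (\<Sum>i=1..m k. score r c q (grad_q r \<alpha> p q) (Y i \<omega>))) (normal_law 0 1)"
      using var V_R1_eq[of r p q \<alpha>] V_R2_eq[of r p q \<alpha>] p q
      by (intro weighted_score_clt[OF s t]) (auto simp: V1_def V2_def)
    moreover have "N k *
        ((\<Sum>j=1..r. grad_p r \<alpha> p q j * (emp_prob X (n k) (c j) \<omega> - p j))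
          + (\<Sum>j=1..r. grad_q r \<alpha> p q j * (emp_prob Y (m k) (c j) \<omega> - q j)))
      = N k / n k * (\<Sum>i=1..n k. score r c p (grad_p r \<alpha> p q) (X i \<omega>))
        + N k / m k * (\<Sum>i=1..m k. score r c q (grad_q r \<alpha> p q) (Y i \<omega>))" for k \<omega>
      unfolding distrib_left
      by (intro arg_cong2[where f = "(+)"] mult_sum_diff_eq_score) (auto simp: N_def)
    ultimately show "conv_in_distr M (\<lambda>k \<omega>. N k *
        ((\<Sum>j=1..r. grad_p r \<alpha> p q j * (emp_prob X (n k) (c j) \<omega> - p j))
          + (\<Sum>j=1..r. grad_q r \<alpha> p q j * (emp_prob Y (m k) (c j) \<omega> - q j)))) (normal_law 0 1)"
      by simp
    let ?C = "\<lambda>p. \<Sum>j=1..r. 1 + multinomial_var r p (\<lambda>i. of_bool (i = j))"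
    have C: "0 \<le> ?C p" "0 \<le> ?C q"
      using X.multinomial_var_nonneg Y.multinomial_var_nonneg by (auto intro!: sum_nonneg add_nonneg_nonneg)
    show "N k * X.expectation (\<lambda>\<omega>. l1_dist r (\<lambda>j. emp_prob X (n k) (c j) \<omega>) p) \<le> U * ?C p" for k
      using mult_mono'[OF U[of k] X.l1_dist_emp_prob(2)[of "n k"] uw_nonneg(1)]
      by (simp add: N_u ac_simps l1_dist_nonneg)
    show "N k * X.expectation (\<lambda>\<omega>. l1_dist r (\<lambda>j. emp_prob Y (m k) (c j) \<omega>) q) \<le> W * ?C q" for k
      using mult_mono'[OF W[of k] Y.l1_dist_emp_prob(2)[of "m k"] uw_nonneg(2)]
      by (simp add: N_w ac_simps l1_dist_nonneg)
  qed (use X.borel_measurable_emp_prob X.l1_dist_emp_prob(1)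
      Y.borel_measurable_emp_prob Y.l1_dist_emp_prob(1) in auto)
  then show ?thesis
    by (simp add: N_def V1_def V2_def)
qed

end

section \<open>The ratio condition and the combined statement\<close>

text \<open>The quotient is half the harmonic mean of the sample sizes, hence at least half of the
  smaller one.\<close>

lemma harmonic_ratio_not_convergent:
  fixes n m :: "nat \<Rightarrow> nat"
  assumes n: "filterlim n at_top sequentially" and m: "filterlim m at_top sequentially"
  shows "\<not> (\<lambda>k. real (n k) * real (m k) / (real (n k) + real (m k))) \<longlonglongrightarrow> \<gamma>"
proof
  assume lim: "(\<lambda>k. real (n k) * real (m k) / (real (n k) + real (m k))) \<longlonglongrightarrow> \<gamma>"
  \<comment> \<open>Half of \<open>b\<close> is at least \<gamma> + 1, contradicting the eventual
    upper bound; the added 1 keeps \<open>b\<close> positive even for negative \<gamma>.\<close>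
  define b where "b = nat \<lceil>2 * (\<gamma> + 1)\<rceil> + 1"
  have "\<forall>\<^sub>F k in sequentially. b \<le> n k" "\<forall>\<^sub>F k in sequentially. b \<le> m k"
    using n m by (auto simp: filterlim_at_top)
  moreover have "\<forall>\<^sub>F k in sequentially. real (n k) * real (m k) / (real (n k) + real (m k)) < \<gamma> + 1"
    using order_tendstoD(2)[OF lim, of "\<gamma> + 1"] by simp
  ultimately have "\<forall>\<^sub>F k in sequentially. False"
  proof eventually_elim
    case (elim k)
    have b: "1 \<le> b" "2 * (\<gamma> + 1) \<le> real b"
      unfolding b_def by linarith+
    have "real b * (real (n k) + real (m k)) \<le> real (m k) * real (n k) + real (n k) * real (m k)"
      unfolding distrib_left using elim by (intro add_mono mult_right_mono) auto
    then have "real b / 2 \<le> real (n k) * real (m k) / (real (n k) + real (m k))"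
      using elim b by (simp add: pos_le_divide_eq algebra_simps)
    then show ?case
      using order.strict_trans1[OF _ elim(3)] b(2) by fastforce
  qed
  then show False
    by simp
qed

text \<open>The ratio condition is a disjunction, pairing the literal nm/(n+m) with the proportion
  m/(n+m), which can converge inside (0,1). The nonvanishing denominator rules out degenerate cases
  such as p = q, where both gradients are constant and both variances are 0.\<close>

theorem corollary6:
  fixes M :: "'w measure" and X Y :: "nat \<Rightarrow> 'w \<Rightarrow> 'a"
    and r :: nat and c :: "nat \<Rightarrow> 'a" and p q :: "nat \<Rightarrow> real" and \<alpha> :: real
  assumes "prob_space M"
    and "r \<ge> 2" and "inj_on c {1..r}"
    and "\<And>j. j \<in> {1..r} \<Longrightarrow> p j > 0" and "(\<Sum>j=1..r. p j) = 1"
    and "\<And>j. j \<in> {1..r} \<Longrightarrow> q j > 0" and "(\<Sum>j=1..r. q j) = 1"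
    and "\<alpha> > 0" and "\<alpha> \<noteq> 1"
    and "prob_space.indep_vars M (\<lambda>_. count_space (c ` {1..r})) (case_sum X Y) ({1..} <+> {1..})"
    and "\<And>i j. i \<ge> 1 \<Longrightarrow> j \<in> {1..r} \<Longrightarrow> measure M {\<omega> \<in> space M. X i \<omega> = c j} = p j"
    and "\<And>i j. i \<ge> 1 \<Longrightarrow> j \<in> {1..r} \<Longrightarrow> measure M {\<omega> \<in> space M. Y i \<omega> = c j} = q j"
  shows
    "conv_in_distr M
       (\<lambda>n \<omega>. sqrt (real n) * (renyi_div r \<alpha> (\<lambda>j. emp_prob X n (c j) \<omega>) q - renyi_div r \<alpha> p q))
       (normal_law 0 (V_R1 r \<alpha> p q))
     \<and>
     conv_in_distr M
       (\<lambda>n \<omega>. sqrt (real n) * (renyi_div r \<alpha> p (\<lambda>j. emp_prob Y n (c j) \<omega>) - renyi_div r \<alpha> p q))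
       (normal_law 0 (V_R2 r \<alpha> p q))
     \<and>
     (\<forall>(n :: nat \<Rightarrow> nat) (m :: nat \<Rightarrow> nat) (\<gamma> :: real).
        filterlim n at_top sequentially \<longrightarrow>
        filterlim m at_top sequentially \<longrightarrow>
        0 < \<gamma> \<longrightarrow> \<gamma> < 1 \<longrightarrow>
        ((\<lambda>k. real (n k) * real (m k) / (real (n k) + real (m k))) \<longlonglongrightarrow> \<gamma> \<or>
         (\<lambda>k. real (m k) / (real (n k) + real (m k))) \<longlonglongrightarrow> \<gamma>) \<longrightarrow>
        (\<forall>\<^sub>F k in sequentially.
           real (n k) * V_R2 r \<alpha> p q + real (m k) * V_R1 r \<alpha> p q \<noteq> 0) \<longrightarrow>
        conv_in_distr M
          (\<lambda>k \<omega>. sqrt (real (m k) * real (n k) /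
                       (real (n k) * V_R2 r \<alpha> p q + real (m k) * V_R1 r \<alpha> p q)) *
            (renyi_div r \<alpha> (\<lambda>j. emp_prob X (n k) (c j) \<omega>) (\<lambda>j. emp_prob Y (m k) (c j) \<omega>)
              - renyi_div r \<alpha> p q))
          (normal_law 0 1))"
proof -
  interpret prob_space M
    by fact
  have X_indep: "indep_vars (\<lambda>_. count_space (c ` {1..r})) X {1..}"
    using indep_vars_reindex[OF indep_vars_subset[OF assms(10)], of Inl "{1..}"] by (auto simp: inj_on_def)
  have Y_indep: "indep_vars (\<lambda>_. count_space (c ` {1..r})) Y {1..}"
    using indep_vars_reindex[OF indep_vars_subset[OF assms(10)], of Inr "{1..}"] by (auto simp: inj_on_def)
  interpret two_categorical_samples M X Y r c p q
    by unfold_locales (fact assms X_indep Y_indep)+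
  have r: "1 \<le> r"
    using assms(2) by simp
  show ?thesis
  proof (intro conjI allI impI, goal_cases)
    case 1
    show ?case
      by (rule renyi_div_clt_first[OF assms(4,6) r assms(9)])
  next
    case 2
    show ?case
      by (rule renyi_div_clt_second[OF assms(4,6) r assms(9)])
  next
    case (3 n m \<gamma>)
    \<comment> \<open>One index with a nonzero denominator already excludes that both variances
      vanish.\<close>
    have "V_R1 r \<alpha> p q \<noteq> 0 \<or> V_R2 r \<alpha> p q \<noteq> 0"
      using eventually_happens[OF 3(6)] by auto
    (* n m / (n + m) tends to infinity, so only the second reading of the ratio condition can hold. *)
    moreover have "(\<lambda>k. real (m k) / (real (n k) + real (m k))) \<longlonglongrightarrow> \<gamma>"
      using 3(5) harmonic_ratio_not_convergent[OF 3(1,2)] by blast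
    ultimately show ?case
      using renyi_div_clt_two_samples[OF assms(4,6) r assms(9) 3(1,2,3,4)] by blast
  qed
qed

end
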